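(* Let $p$ be a prime number, let $\rho$ be any shift with $\#T_\rho<\infty$ and let $f$ be a positive integer. Then there exists a unique map $$\text{filt-ord}: p\cdot(M_\rho^{f-1}\oplus M_\rho^* )\to \mathrm{Jump}_\rho^*$$ having the following two properties. (1) For all $v_1,v_2\in p\cdot(M_\rho^{f-1}\oplus M_\rho^* )$, the vectors $v_1$ and $v_2$ are in the same orbit under $\mathrm{Aut}_{\mathrm{filt}}(M_\rho^{f-1}\oplus M_\rho^* )$ if and only if $\text{filt-ord}(v_1)=\text{filt-ord}(v_2)$. (2) For each $(I,\beta)\in\mathrm{Jump}_\rho^*$ we have $\text{filt-ord}(v_{(I,\beta)})=(I,\beta)$.
   Context: A filtered $\mathbb{Z}_p$-module $M_\bullet$ is a sequence of $\mathbb{Z}_p$-modules $M_1\supseteq M_2\supseteq\cdots$ with $\bigcap_i M_i=\{0\}$; its weight map $w(x)=\sup\{i: x\in M_i\}$ determines the filtration. A morphism $M_\bullet\to N_\bullet$ is a $\mathbb{Z}_p$-linear map $\phi:M_1\to N_1$ with $\phi(M_i)\subseteq N_i$ for all $i$; $\mathrm{Aut}_{\mathrm{filt}}(M_\bullet)$ is the group of invertible morphisms $M_\bullet\to M_\bullet$ (with inverse a morphism). Products and direct sums carry the termwise filtration. A shift is a strictly increasing function $\rho:\mathbb{Z}_{\ge1}\to\mathbb{Z}_{\ge1}$ with $\rho(1)>1$; $T_\rho=\mathbb{Z}_{\ge1}\setminus\rho(\mathbb{Z}_{\ge1})$. If $T_\rho$ is finite, $e^*=\max(T_\rho)+1$ and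 $T_\rho^*=T_\rho\cup\{e^*\}$. For $i\ge1$, $S_i$ is the filtered module $\mathbb{Z}_p$ with weight map $w(x)=\rho^{\mathrm{ord}_p(x)}(i)$ (iterate of $\rho$; $w(0)=\infty$). $M_\rho=\prod_{i\in T_\rho}S_i$, $M_\rho^*=\prod_{i\in T_\rho^*}S_i$; $M_\rho^{f-1}$ is the direct sum of $f-1$ copies of $M_\rho$. $\mathrm{Jump}_\rho^*$, the set of extended $\rho$-jump sets, is the set of pairs $(I,\beta)$ with $I\subseteq T_\rho^*$ a finite subset (possibly empty) and $\beta:I\to\mathbb{Z}_{\ge1}$ a strictly decreasing map such that $i\mapsto\rho^{\beta(i)}(i)$ is strictly increasing on $I$. For $(I,\beta)\in\mathrm{Jump}_\rho^*$, $v_{(I,\beta)}=(x_j)_{j\in T_\rho^*}\in p\cdot M_\rho^*\subseteq p\cdot(M_\rho^{f-1}\oplus M_\rho^* )$ is defined by $x_j=0$ if $j\notin I$ and $x_j=p^{\beta(j)}$ if $j\in I$. *)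

theory Defs
  imports
    "HOL-Algebra.Algebra"
    "HOL-Library.Extended_Nat"
    "HOL-Computational_Algebra.Primes"
begin

section \<open>The ring of p-adic integers\<close>

text \<open>
  The inverse limit of the rings Z/p^n: an element is its sequence of least nonnegative
  residues modulo p^n.
\<close>

definition Zp :: "nat \<Rightarrow> (nat \<Rightarrow> int) ring" where
  "Zp p = \<lparr>carrier = {x. \<forall>n. 0 \<le> x n \<and> x n < int p ^ n \<and> x (Suc n) mod int p ^ n = x n},
           monoid.mult = (\<lambda>x y n. (x n * y n) mod int p ^ n),
           monoid.one = (\<lambda>n. 1 mod int p ^ n),
           ring.zero = (\<lambda>n. 0),
           ring.add = (\<lambda>x y n. (x n + y n) mod int p ^ n)\<rparr>"

definition Zp_of_nat :: "nat \<Rightarrow> nat \<Rightarrow> (nat \<Rightarrow> int)" where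
  "Zp_of_nat p k = [k] \<cdot>\<^bsub>Zp p\<^esub> \<one>\<^bsub>Zp p\<^esub>"

text \<open>Meaningful only for nonzero elements.\<close>

definition Zp_ord :: "nat \<Rightarrow> (nat \<Rightarrow> int) \<Rightarrow> nat" where
  "Zp_ord p x = (GREATEST n. Zp_of_nat p (p ^ n) divides\<^bsub>Zp p\<^esub> x)"


section \<open>Filtered modules\<close>

text \<open>
  As for library modules, the fields \<^term>\<open>monoid.mult\<close> and \<^term>\<open>one\<close> inherited from rings
  carry no meaning. The value of the filtration at index 0 carries no meaning either.
\<close>

record ('a, 'b) filtered_module = "('a, 'b) module" +
  filt :: "nat \<Rightarrow> 'b set"

locale filtered_module = module R M for R (structure) and M :: "('a, 'b, 'c) filtered_module_scheme" (structure) +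
  assumes filt_submodule: "n \<ge> 1 \<Longrightarrow> submodule (filt M n) R M"
    and filt_1: "filt M 1 = carrier M"
    and filt_decr: "n \<ge> 1 \<Longrightarrow> filt M (Suc n) \<subseteq> filt M n"
    and filt_Inter: "(\<Inter>n\<in>{1..}. filt M n) = {\<zero>\<^bsub>M\<^esub>}"

definition filt_hom ::
  "('a, 'r) ring_scheme \<Rightarrow> ('a, 'b, 'm) filtered_module_scheme \<Rightarrow>
    ('a, 'c, 'n) filtered_module_scheme \<Rightarrow> ('b \<Rightarrow> 'c) set" where
  "filt_hom R M N = {\<phi> \<in> carrier M \<rightarrow>\<^sub>E carrier N.
     (\<forall>x\<in>carrier M. \<forall>y\<in>carrier M. \<phi> (x \<oplus>\<^bsub>M\<^esub> y) = \<phi> x \<oplus>\<^bsub>N\<^esub> \<phi> y) \<and>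
     (\<forall>a\<in>carrier R. \<forall>x\<in>carrier M. \<phi> (a \<odot>\<^bsub>M\<^esub> x) = a \<odot>\<^bsub>N\<^esub> \<phi> x) \<and>
     (\<forall>n\<ge>1. \<phi> ` filt M n \<subseteq> filt N n)}"

definition filt_auts ::
  "('a, 'r) ring_scheme \<Rightarrow> ('a, 'b, 'm) filtered_module_scheme \<Rightarrow> ('b \<Rightarrow> 'b) set" where
  "filt_auts R M = {\<phi> \<in> filt_hom R M M.
     \<exists>\<psi>\<in>filt_hom R M M. \<forall>x\<in>carrier M. \<psi> (\<phi> x) = x \<and> \<phi> (\<psi> x) = x}"

definition Aut_filt ::
  "('a, 'r) ring_scheme \<Rightarrow> ('a, 'b, 'm) filtered_module_scheme \<Rightarrow> ('b \<Rightarrow> 'b) monoid" where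
  "Aut_filt R M = BijGroup (carrier M) \<lparr>carrier := filt_auts R M\<rparr>"

text \<open>
  Over a finite index set the product is also the direct sum.
\<close>

definition filt_prod ::
  "'i set \<Rightarrow> ('i \<Rightarrow> ('a, 'b, 'm) filtered_module_scheme) \<Rightarrow> ('a, 'i \<Rightarrow> 'b) filtered_module" where
  "filt_prod I M = \<lparr>carrier = (\<Pi>\<^sub>E i\<in>I. carrier (M i)),
     monoid.mult = undefined, monoid.one = undefined,
     ring.zero = (\<lambda>i\<in>I. \<zero>\<^bsub>M i\<^esub>),
     ring.add = (\<lambda>x y. \<lambda>i\<in>I. x i \<oplus>\<^bsub>M i\<^esub> y i),
     module.smult = (\<lambda>a x. \<lambda>i\<in>I. a \<odot>\<^bsub>M i\<^esub> x i),
     filt = (\<lambda>n. \<Pi>\<^sub>E i\<in>I. filt (M i) n)\<rparr>"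

definition filt_sum ::
  "('a, 'b, 'm) filtered_module_scheme \<Rightarrow> ('a, 'c, 'n) filtered_module_scheme \<Rightarrow>
    ('a, 'b \<times> 'c) filtered_module" where
  "filt_sum M N = \<lparr>carrier = carrier M \<times> carrier N,
     monoid.mult = undefined, monoid.one = undefined,
     ring.zero = (\<zero>\<^bsub>M\<^esub>, \<zero>\<^bsub>N\<^esub>),
     ring.add = (\<lambda>(x, y) (x', y'). (x \<oplus>\<^bsub>M\<^esub> x', y \<oplus>\<^bsub>N\<^esub> y')),
     module.smult = (\<lambda>a (x, y). (a \<odot>\<^bsub>M\<^esub> x, a \<odot>\<^bsub>N\<^esub> y)),
     filt = (\<lambda>n. filt M n \<times> filt N n)\<rparr>"

definition nat_multiples :: "nat \<Rightarrow> ('b, 'm) ring_scheme \<Rightarrow> 'b set" where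
  "nat_multiples k M = (\<lambda>x. [k] \<cdot>\<^bsub>M\<^esub> x) ` carrier M"


section \<open>Shifts and the modules attached to them\<close>

text \<open>A shift is a function on the positive integers, so the value at 0 is never used.\<close>

definition shift :: "(nat \<Rightarrow> nat) \<Rightarrow> bool" where
  "shift \<rho> \<longleftrightarrow> strict_mono_on {1..} \<rho> \<and> \<rho> 1 > 1"

definition T_set :: "(nat \<Rightarrow> nat) \<Rightarrow> nat set" where
  "T_set \<rho> = {1..} - \<rho> ` {1..}"

definition e_star :: "(nat \<Rightarrow> nat) \<Rightarrow> nat" where
  "e_star \<rho> = Max (T_set \<rho>) + 1"

definition T_star :: "(nat \<Rightarrow> nat) \<Rightarrow> nat set" where
  "T_star \<rho> = T_set \<rho> \<union> {e_star \<rho>}"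

definition S_weight :: "nat \<Rightarrow> (nat \<Rightarrow> nat) \<Rightarrow> nat \<Rightarrow> (nat \<Rightarrow> int) \<Rightarrow> enat" where
  "S_weight p \<rho> i x = (if x = \<zero>\<^bsub>Zp p\<^esub> then \<infinity> else enat ((\<rho> ^^ Zp_ord p x) i))"

definition S_mod :: "nat \<Rightarrow> (nat \<Rightarrow> nat) \<Rightarrow> nat \<Rightarrow> (nat \<Rightarrow> int, nat \<Rightarrow> int) filtered_module" where
  "S_mod p \<rho> i = \<lparr>carrier = carrier (Zp p),
     monoid.mult = undefined, monoid.one = undefined,
     ring.zero = \<zero>\<^bsub>Zp p\<^esub>,
     ring.add = (\<lambda>x y. x \<oplus>\<^bsub>Zp p\<^esub> y),
     module.smult = (\<lambda>a x. a \<otimes>\<^bsub>Zp p\<^esub> x),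
     filt = (\<lambda>n. {x \<in> carrier (Zp p). S_weight p \<rho> i x \<ge> enat n})\<rparr>"

definition M_rho ::
  "nat \<Rightarrow> (nat \<Rightarrow> nat) \<Rightarrow> (nat \<Rightarrow> int, nat \<Rightarrow> nat \<Rightarrow> int) filtered_module" where
  "M_rho p \<rho> = filt_prod (T_set \<rho>) (S_mod p \<rho>)"

definition M_rho_star ::
  "nat \<Rightarrow> (nat \<Rightarrow> nat) \<Rightarrow> (nat \<Rightarrow> int, nat \<Rightarrow> nat \<Rightarrow> int) filtered_module" where
  "M_rho_star p \<rho> = filt_prod (T_star \<rho>) (S_mod p \<rho>)"

definition M_total ::
  "nat \<Rightarrow> (nat \<Rightarrow> nat) \<Rightarrow> nat \<Rightarrow>
    (nat \<Rightarrow> int, (nat \<Rightarrow> nat \<Rightarrow> nat \<Rightarrow> int) \<times> (nat \<Rightarrow> nat \<Rightarrow> int)) filtered_module" where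
  "M_total p \<rho> f = filt_sum (filt_prod {1..f - 1} (\<lambda>_. M_rho p \<rho>)) (M_rho_star p \<rho>)"


section \<open>Extended jump sets\<close>

text \<open>The map on I is represented by its extensional extension, so that equality of pairs is
  equality of jump sets.\<close>

definition Jump_star :: "(nat \<Rightarrow> nat) \<Rightarrow> (nat set \<times> (nat \<Rightarrow> nat)) set" where
  "Jump_star \<rho> = {(I, \<beta>). finite I \<and> I \<subseteq> T_star \<rho> \<and> \<beta> \<in> I \<rightarrow>\<^sub>E {1..} \<and>
     strict_antimono_on I \<beta> \<and> strict_mono_on I (\<lambda>i. (\<rho> ^^ \<beta> i) i)}"

definition jump_vector ::
  "nat \<Rightarrow> (nat \<Rightarrow> nat) \<Rightarrow> nat \<Rightarrow> nat set \<times> (nat \<Rightarrow> nat) \<Rightarrow>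
    (nat \<Rightarrow> nat \<Rightarrow> nat \<Rightarrow> int) \<times> (nat \<Rightarrow> nat \<Rightarrow> int)" where
  "jump_vector p \<rho> f = (\<lambda>(I, \<beta>).
     (\<zero>\<^bsub>filt_prod {1..f - 1} (\<lambda>_. M_rho p \<rho>)\<^esub>,
      \<lambda>j\<in>T_star \<rho>. if j \<in> I then Zp_of_nat p (p ^ \<beta> j) else \<zero>\<^bsub>Zp p\<^esub>))"


section \<open>The objects above are of the intended kind\<close>

lemma Zp_coherent: "x \<in> carrier (Zp p) \<Longrightarrow> x (n + k) mod int p ^ n = x n"
proof (induction k)
  case 0 then show ?case by (auto simp: Zp_def)
next
  case (Suc k)
  have "x (Suc (n + k)) mod int p ^ (n + k) = x (n + k)" using Suc.prems by (simp add: Zp_def)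
  then have "x (n + k) mod int p ^ n = x (Suc (n + k)) mod int p ^ n"
    by (metis le_add1 le_imp_power_dvd mod_mod_cancel)
  then show ?case using Suc by simp
qed

lemma mod_pow_Suc: "(x mod int p ^ Suc n) mod int p ^ n = x mod int p ^ n"
  by (rule mod_mod_cancel) simp

lemma Zp_mod_self: "x \<in> carrier (Zp p) \<Longrightarrow> x n mod int p ^ n = x n"
  by (simp add: Zp_def)

lemma Zp_Suc: "x \<in> carrier (Zp p) \<Longrightarrow> x (Suc n) mod int p ^ n = x n"
  by (simp add: Zp_def)

lemma Zp_I: "p > 0 \<Longrightarrow> (\<And>n. g (Suc n) mod int p ^ n = g n mod int p ^ n) \<Longrightarrow>
   (\<lambda>n. g n mod int p ^ n) \<in> carrier (Zp p)"
  by (simp add: Zp_def mod_pow_Suc[unfolded power_Suc])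

lemma cring_Zp:
  assumes "p > 0"
  shows "cring (Zp p)"
proof -
  have add_c: "x \<oplus>\<^bsub>Zp p\<^esub> y \<in> carrier (Zp p)" if "x \<in> carrier (Zp p)" "y \<in> carrier (Zp p)" for x y
  proof -
    have "(\<lambda>n. (x n + y n) mod int p ^ n) \<in> carrier (Zp p)"
      using Zp_Suc[OF that(1)] Zp_Suc[OF that(2)] by (intro Zp_I assms) (metis mod_add_eq)
    then show ?thesis by (simp add: Zp_def)
  qed
  have mult_c: "x \<otimes>\<^bsub>Zp p\<^esub> y \<in> carrier (Zp p)" if "x \<in> carrier (Zp p)" "y \<in> carrier (Zp p)" for x y
  proof -
    have "(\<lambda>n. (x n * y n) mod int p ^ n) \<in> carrier (Zp p)"
      using Zp_Suc[OF that(1)] Zp_Suc[OF that(2)] by (intro Zp_I assms) (metis mod_mult_eq)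
    then show ?thesis by (simp add: Zp_def)
  qed
  have neg: "\<exists>y\<in>carrier (Zp p). y \<oplus>\<^bsub>Zp p\<^esub> x = \<zero>\<^bsub>Zp p\<^esub>" if "x \<in> carrier (Zp p)" for x
  proof
    show "(\<lambda>n. (- x n) mod int p ^ n) \<in> carrier (Zp p)"
      using Zp_Suc[OF that] by (intro Zp_I assms) (metis mod_minus_eq)
    show "(\<lambda>n. (- x n) mod int p ^ n) \<oplus>\<^bsub>Zp p\<^esub> x = \<zero>\<^bsub>Zp p\<^esub>"
      by (simp add: Zp_def fun_eq_iff mod_add_left_eq)
  qed
  have one_c: "\<one>\<^bsub>Zp p\<^esub> \<in> carrier (Zp p)"
    using Zp_I[OF assms, of "\<lambda>_. 1"] by (simp add: Zp_def)
  have zero_c: "\<zero>\<^bsub>Zp p\<^esub> \<in> carrier (Zp p)"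
    using assms by (simp add: Zp_def)
  show ?thesis
  proof (intro cringI abelian_groupI comm_monoidI)
    fix x y z assume "x \<in> carrier (Zp p)" "y \<in> carrier (Zp p)" "z \<in> carrier (Zp p)"
    show "x \<oplus>\<^bsub>Zp p\<^esub> y \<oplus>\<^bsub>Zp p\<^esub> z = x \<oplus>\<^bsub>Zp p\<^esub> (y \<oplus>\<^bsub>Zp p\<^esub> z)"
      by (simp add: Zp_def fun_eq_iff mod_add_left_eq mod_add_right_eq add.assoc)
    show "x \<otimes>\<^bsub>Zp p\<^esub> y \<otimes>\<^bsub>Zp p\<^esub> z = x \<otimes>\<^bsub>Zp p\<^esub> (y \<otimes>\<^bsub>Zp p\<^esub> z)"
      by (simp add: Zp_def fun_eq_iff mod_mult_left_eq mod_mult_right_eq mult.assoc)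
    show "(x \<oplus>\<^bsub>Zp p\<^esub> y) \<otimes>\<^bsub>Zp p\<^esub> z = x \<otimes>\<^bsub>Zp p\<^esub> z \<oplus>\<^bsub>Zp p\<^esub> y \<otimes>\<^bsub>Zp p\<^esub> z"
      by (simp add: Zp_def fun_eq_iff mod_mult_left_eq mod_add_eq distrib_right)
  next
    fix x assume x: "x \<in> carrier (Zp p)"
    show "\<zero>\<^bsub>Zp p\<^esub> \<oplus>\<^bsub>Zp p\<^esub> x = x" using Zp_mod_self[OF x] by (simp add: Zp_def fun_eq_iff)
    show "\<one>\<^bsub>Zp p\<^esub> \<otimes>\<^bsub>Zp p\<^esub> x = x"
      using Zp_mod_self[OF x] by (simp add: Zp_def fun_eq_iff mod_mult_left_eq)
  next
    fix x y
    show "x \<oplus>\<^bsub>Zp p\<^esub> y = y \<oplus>\<^bsub>Zp p\<^esub> x" by (simp add: Zp_def add.commute)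
    show "x \<otimes>\<^bsub>Zp p\<^esub> y = y \<otimes>\<^bsub>Zp p\<^esub> x" by (simp add: Zp_def mult.commute)
  qed (use add_c mult_c neg one_c zero_c in auto)
qed

lemma Zp_of_nat_eq: "Zp_of_nat p k = (\<lambda>n. int k mod int p ^ n)"
proof (induction k)
  case 0 then show ?case by (simp add: Zp_of_nat_def add_pow_def) (simp add: Zp_def)
next
  case (Suc k)
  have "Zp_of_nat p (Suc k) = Zp_of_nat p k \<oplus>\<^bsub>Zp p\<^esub> \<one>\<^bsub>Zp p\<^esub>"
    by (simp add: Zp_of_nat_def add_pow_def)
  also have "\<dots> = (\<lambda>n. int (Suc k) mod int p ^ n)" unfolding Suc
    by (simp add: Zp_def fun_eq_iff mod_add_eq add.commute)
  finally show ?case .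
qed

lemma Zp_divides_iff:
  assumes x: "x \<in> carrier (Zp p)" and p: "p > 0"
  shows "Zp_of_nat p (p ^ n) divides\<^bsub>Zp p\<^esub> x \<longleftrightarrow> x n = 0"
proof
  assume "Zp_of_nat p (p ^ n) divides\<^bsub>Zp p\<^esub> x"
  then show "x n = 0" by (auto simp: factor_def Zp_of_nat_eq) (simp add: Zp_def)
next
  assume x0: "x n = 0"
  define y where "y = (\<lambda>k. x (n + k) div int p ^ n)"
  have d: "x (n + k) = int p ^ n * y k" for k
    using Zp_coherent[OF x, of n k] x0 by (auto simp: y_def)
  have P: "int p ^ n > 0" for n using p by simp
  have "y \<in> carrier (Zp p)"
  proof -
    have "0 \<le> y k \<and> y k < int p ^ k \<and> y (Suc k) mod int p ^ k = y k" for k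
    proof (intro conjI)
      have *: "0 \<le> x (n + k)" "x (n + k) < int p ^ (n + k)" using x by (auto simp: Zp_def)
      then show "0 \<le> y k" using P[of n] by (simp add: y_def pos_imp_zdiv_nonneg_iff)
      show "y k < int p ^ k" using * P[of n] by (simp add: d power_add)
      have "x (n + Suc k) mod int p ^ (n + k) = x (n + k)" using Zp_Suc[OF x, of "n + k"] by simp
      then have "int p ^ n * (y (Suc k) mod int p ^ k) = int p ^ n * y k"
        by (simp only: d power_add mult_mod_right)
      then show "y (Suc k) mod int p ^ k = y k" using p by simp
    qed
    then show ?thesis by (simp add: Zp_def)
  qed
  moreover have "x = Zp_of_nat p (p ^ n) \<otimes>\<^bsub>Zp p\<^esub> y"
  proof
    fix m
    have "x m = x (m + n) mod int p ^ m" using Zp_coherent[OF x] by simp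
    also have "\<dots> = (int p ^ n * y m) mod int p ^ m" using d[of m] by (simp add: add.commute)
    finally show "x m = (Zp_of_nat p (p ^ n) \<otimes>\<^bsub>Zp p\<^esub> y) m"
      unfolding Zp_of_nat_eq by (simp add: Zp_def mod_mult_left_eq)
  qed
  ultimately show "Zp_of_nat p (p ^ n) divides\<^bsub>Zp p\<^esub> x" by (auto simp: factor_def)
qed

lemma Zp_vanish_mono:
  assumes x: "x \<in> carrier (Zp p)" and "x n = 0" "m \<le> n"
  shows "x m = 0"
  using Zp_coherent[OF x, of m "n - m"] assms by simp

lemma Zp_ord_ge_iff:
  assumes x: "x \<in> carrier (Zp p)" and p: "p > 0" and nz: "x \<noteq> \<zero>\<^bsub>Zp p\<^esub>"
  shows "n \<le> Zp_ord p x \<longleftrightarrow> x n = 0"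
proof -
  have e: "Zp_ord p x = (GREATEST n. x n = 0)"
    by (simp add: Zp_ord_def Zp_divides_iff[OF x p])
  obtain N where N: "x N \<noteq> 0" using nz by (auto simp: Zp_def fun_eq_iff)
  have b: "m \<le> N" if "x m = 0" for m using Zp_vanish_mono[OF x that, of N] N by fastforce
  have "x 0 = 0" using x unfolding Zp_def by (simp add: ) (metis int_one_le_iff_zero_less linorder_not_le order_antisym power_0)
  then have "x (Zp_ord p x) = 0" unfolding e by (rule GreatestI_nat[of _ _ N]) (use b in auto)
  moreover have "n \<le> Zp_ord p x" if "x n = 0" unfolding e by (rule Greatest_le_nat[of _ _ N]) (use that b in auto)
  ultimately show ?thesis using Zp_vanish_mono[OF x] by blast
qed

lemma shift_ge: assumes "shift \<rho>" "i \<ge> 1" shows "i < \<rho> i"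
  using assms(2)
proof (induction i rule: dec_induct)
  case base then show ?case using assms by (simp add: shift_def)
next
  case (step n)
  have "\<rho> n < \<rho> (Suc n)" using assms step by (auto simp: shift_def strict_mono_on_def)
  then show ?case using step by linarith
qed

lemma shift_pow: assumes "shift \<rho>" "i \<ge> 1" shows "(\<rho> ^^ n) i \<ge> n + i"
proof (induction n)
  case (Suc n) then show ?case using shift_ge[OF assms(1), of "(\<rho> ^^ n) i"] assms(2) by simp
qed simp

lemma shift_pow_mono: assumes "shift \<rho>" "i \<ge> 1" "m \<le> n" shows "(\<rho> ^^ m) i \<le> (\<rho> ^^ n) i"
  using assms(3)
proof (induction n rule: dec_induct)
  case (step n) then show ?case using shift_ge[OF assms(1), of "(\<rho> ^^ n) i"] shift_pow[OF assms(1,2), of n] assms(2) by simp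
qed simp

lemma S_weight_ge_iff:
  assumes "shift \<rho>" "i \<ge> 1" "p > 0" "x \<in> carrier (Zp p)"
  shows "S_weight p \<rho> i x \<ge> enat n \<longleftrightarrow> x (LEAST k. (\<rho> ^^ k) i \<ge> n) = 0"
proof (cases "x = \<zero>\<^bsub>Zp p\<^esub>")
  case True then show ?thesis by (simp add: S_weight_def) (simp add: Zp_def)
next
  case False
  let ?L = "LEAST k. (\<rho> ^^ k) i \<ge> n"
  have L: "(\<rho> ^^ ?L) i \<ge> n" by (rule LeastI[where P="\<lambda>k. (\<rho> ^^ k) i \<ge> n" and k=n]) (use shift_pow[OF assms(1,2), of n] in simp)
  have "n \<le> (\<rho> ^^ k) i \<longleftrightarrow> ?L \<le> k" for k
    using shift_pow_mono[OF assms(1,2)] L by (meson Least_le le_trans)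
  note K = this[of "Zp_ord p x"]
  have "S_weight p \<rho> i x \<ge> enat n \<longleftrightarrow> n \<le> (\<rho> ^^ Zp_ord p x) i" using False by (simp add: S_weight_def)
  then show ?thesis unfolding K Zp_ord_ge_iff[OF assms(4,3) False] .
qed

lemma a_inv_mod: "module R M \<Longrightarrow> x \<in> carrier M \<Longrightarrow> (\<ominus>\<^bsub>R\<^esub> \<one>\<^bsub>R\<^esub>) \<odot>\<^bsub>M\<^esub> x = \<ominus>\<^bsub>M\<^esub> x"
  by (metis abelian_group.a_inv_closed module.axioms(1) module.smult_l_minus module.smult_one cring.cring_simprules(6))

lemma filtered_moduleI:
  assumes "module R M"
    and "\<And>n. n \<ge> 1 \<Longrightarrow> filt M n \<subseteq> carrier M"
    and "\<And>n. n \<ge> 1 \<Longrightarrow> \<zero>\<^bsub>M\<^esub> \<in> filt M n"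
    and "\<And>n x y. n \<ge> 1 \<Longrightarrow> x \<in> filt M n \<Longrightarrow> y \<in> filt M n \<Longrightarrow> x \<oplus>\<^bsub>M\<^esub> y \<in> filt M n"
    and "\<And>n a x. n \<ge> 1 \<Longrightarrow> a \<in> carrier R \<Longrightarrow> x \<in> filt M n \<Longrightarrow> a \<odot>\<^bsub>M\<^esub> x \<in> filt M n"
    and "filt M 1 = carrier M"
    and "\<And>n. n \<ge> 1 \<Longrightarrow> filt M (Suc n) \<subseteq> filt M n"
    and "(\<Inter>n\<in>{1..}. filt M n) = {\<zero>\<^bsub>M\<^esub>}"
  shows "filtered_module R M"
proof -
  interpret module R M by fact
  have "\<ominus>\<^bsub>M\<^esub> x \<in> filt M n" if "n \<ge> 1" "x \<in> filt M n" for n x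
    using assms(5)[OF that(1) _ that(2), of "\<ominus>\<^bsub>R\<^esub> \<one>\<^bsub>R\<^esub>"] assms(2)[OF that(1)] that(2)
      a_inv_mod[OF assms(1)] by auto
  note neg = this
  show ?thesis
    by (intro filtered_module.intro filtered_module_axioms.intro submoduleI)
      (fact assms neg | erule (1) neg | erule (2) assms(4) | erule (2) assms(5) | erule assms(2) assms(3) assms(7))+
qed

lemma filtered_module_S:
  assumes "shift \<rho>" "i \<ge> 1" "p > 0"
  shows "filtered_module (Zp p) (S_mod p \<rho> i)"
proof -
  interpret Z: cring "Zp p" using cring_Zp[OF assms(3)] .
  have F: "filt (S_mod p \<rho> i) n = {x \<in> carrier (Zp p). x (LEAST k. (\<rho> ^^ k) i \<ge> n) = 0}" for n
    using S_weight_ge_iff[OF assms] by (auto simp: S_mod_def)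
  have r [simp]: "carrier (S_mod p \<rho> i) = carrier (Zp p)" "\<zero>\<^bsub>S_mod p \<rho> i\<^esub> = \<zero>\<^bsub>Zp p\<^esub>"
     "x \<oplus>\<^bsub>S_mod p \<rho> i\<^esub> y = x \<oplus>\<^bsub>Zp p\<^esub> y" "x \<odot>\<^bsub>S_mod p \<rho> i\<^esub> y = x \<otimes>\<^bsub>Zp p\<^esub> y" for x y
    by (simp_all add: S_mod_def)
  have "abelian_group (S_mod p \<rho> i)"
  proof (rule abelian_groupI)
    fix x assume "x \<in> carrier (S_mod p \<rho> i)"
    then show "\<exists>y\<in>carrier (S_mod p \<rho> i). y \<oplus>\<^bsub>S_mod p \<rho> i\<^esub> x = \<zero>\<^bsub>S_mod p \<rho> i\<^esub>"
      by (intro bexI[of _ "\<ominus>\<^bsub>Zp p\<^esub> x"]) (auto simp: Z.l_neg)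
  qed (auto simp: Z.a_assoc intro: Z.a_comm)
  then have "module (Zp p) (S_mod p \<rho> i)"
    by (rule moduleI[OF cring_Zp[OF assms(3)]]) (auto simp: Z.l_distr Z.r_distr Z.m_assoc)
  then show ?thesis
  proof (rule filtered_moduleI)
    fix n :: nat
    show "filt (S_mod p \<rho> i) n \<subseteq> carrier (S_mod p \<rho> i)" by (auto simp: F)
    show "\<zero>\<^bsub>S_mod p \<rho> i\<^esub> \<in> filt (S_mod p \<rho> i) n" by (simp add: F) (simp add: Zp_def)
    show "filt (S_mod p \<rho> i) (Suc n) \<subseteq> filt (S_mod p \<rho> i) n"
    proof
      fix x assume "x \<in> filt (S_mod p \<rho> i) (Suc n)"
      then show "x \<in> filt (S_mod p \<rho> i) n"
        using order_trans[of "enat n" "enat (Suc n)" "S_weight p \<rho> i x"] by (simp add: S_mod_def)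
    qed
    fix a x assume "a \<in> carrier (Zp p)" "x \<in> filt (S_mod p \<rho> i) n"
    then show "a \<odot>\<^bsub>S_mod p \<rho> i\<^esub> x \<in> filt (S_mod p \<rho> i) n" unfolding F
      using Z.m_closed[of a x] by auto (simp add: Zp_def)
  next
    fix n :: nat and x y assume "x \<in> filt (S_mod p \<rho> i) n" "y \<in> filt (S_mod p \<rho> i) n"
    then show "x \<oplus>\<^bsub>S_mod p \<rho> i\<^esub> y \<in> filt (S_mod p \<rho> i) n" unfolding F
      using Z.a_closed[of x y] by auto (simp add: Zp_def)
  next
    have "enat 1 \<le> S_weight p \<rho> i x" for x
      using shift_pow[OF assms(1,2), of "Zp_ord p x"] assms(2) by (simp add: S_weight_def)
    then show "filt (S_mod p \<rho> i) 1 = carrier (S_mod p \<rho> i)" by (auto simp: S_mod_def)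
  next
    have "x = \<zero>\<^bsub>Zp p\<^esub>" if "\<And>n. n \<ge> 1 \<Longrightarrow> enat n \<le> S_weight p \<rho> i x" for x
    proof (rule ccontr)
      assume "x \<noteq> \<zero>\<^bsub>Zp p\<^esub>"
      then show False using that[of "Suc ((\<rho> ^^ Zp_ord p x) i)"] by (simp add: S_weight_def)
    qed
    note Z0 = this
    show "(\<Inter>n\<in>{1..}. filt (S_mod p \<rho> i) n) = {\<zero>\<^bsub>S_mod p \<rho> i\<^esub>}" (is "?L = ?R")
    proof
      show "?L \<subseteq> ?R"
      proof
        fix x assume "x \<in> ?L"
        then have "x = \<zero>\<^bsub>Zp p\<^esub>" by (intro Z0) (simp add: S_mod_def)
        then show "x \<in> ?R" by simp
      qed
      show "?R \<subseteq> ?L" by (simp add: S_mod_def S_weight_def)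
    qed
  qed
qed

context
  fixes R :: "('a, 'r) ring_scheme" and M :: "'i \<Rightarrow> ('a, 'b, 'm) filtered_module_scheme" and I
  assumes M: "\<And>i. i \<in> I \<Longrightarrow> filtered_module R (M i)" and R: "cring R"
begin

lemma filtered_module_filt_prod: "filtered_module R (filt_prod I M)"
proof -
  interpret R: cring R by fact
  have mo: "module R (M i)" if "i \<in> I" for i using M[OF that] by (simp add: filtered_module_def)
  have ab: "abelian_group (M i)" if "i \<in> I" for i using mo[OF that] by (simp add: module_def)
  have am: "abelian_monoid (M i)" if "i \<in> I" for i using ab[OF that] by (simp add: abelian_group_def)
  have m: "x i \<in> carrier (M i)" if "x \<in> (\<Pi>\<^sub>E i\<in>I. carrier (M i))" "i \<in> I" for x i
    using that by auto
  note s = abelian_monoid.a_closed[OF am] abelian_monoid.zero_closed[OF am] abelian_monoid.a_assoc[OF am]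
     abelian_monoid.l_zero[OF am] abelian_group.l_neg[OF ab] abelian_group.a_inv_closed[OF ab]
     module.smult_closed[OF mo] module.smult_l_distr[OF mo] module.smult_r_distr[OF mo] 
      module.smult_assoc1[OF mo] module.smult_one[OF mo] m
  have e: "x = y" if "x \<in> PiE I A" "y \<in> PiE I B" "\<And>i. i \<in> I \<Longrightarrow> x i = y i" for x y and A B :: "'i \<Rightarrow> 'b set"
    using that by (intro extensionalityI[of x I y]) (auto simp: PiE_def)
  have sub: "submodule (filt (M i) n) R (M i)" if "i \<in> I" "n \<ge> 1" for i n
    using filtered_module.filt_submodule[OF M] that by auto
  note sm = module.submoduleE[OF mo sub]
  have "module R (filt_prod I M)"
  proof (intro moduleI R abelian_groupI)
    fix x assume "x \<in> carrier (filt_prod I M)"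
    then show "\<exists>y\<in>carrier (filt_prod I M). y \<oplus>\<^bsub>filt_prod I M\<^esub> x = \<zero>\<^bsub>filt_prod I M\<^esub>"
      by (intro bexI[of _ "\<lambda>i\<in>I. \<ominus>\<^bsub>M i\<^esub> x i"]) (auto simp: filt_prod_def s intro!: restrict_ext)
  qed (auto simp: filt_prod_def s intro!: restrict_ext e[rotated 2] abelian_monoid.a_comm[OF am])
  then show ?thesis
  proof (rule filtered_moduleI)
    fix n :: nat assume n: "n \<ge> 1"
    show "filt (filt_prod I M) n \<subseteq> carrier (filt_prod I M)"
      using sm(1)[OF _ _ n] by (auto simp: filt_prod_def PiE_iff)
    show "\<zero>\<^bsub>filt_prod I M\<^esub> \<in> filt (filt_prod I M) n"
      using filtered_module.filt_Inter[OF M] n by (auto simp: filt_prod_def)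
    show "filt (filt_prod I M) (Suc n) \<subseteq> filt (filt_prod I M) n"
      using filtered_module.filt_decr[OF M n] by (auto simp: filt_prod_def PiE_iff)
    fix a x assume "a \<in> carrier R" "x \<in> filt (filt_prod I M) n"
    then show "a \<odot>\<^bsub>filt_prod I M\<^esub> x \<in> filt (filt_prod I M) n"
      using sm(4)[OF _ _ n] by (auto simp: filt_prod_def)
  next
    fix n :: nat and x y assume n: "n \<ge> 1" "x \<in> filt (filt_prod I M) n" "y \<in> filt (filt_prod I M) n"
    then show "x \<oplus>\<^bsub>filt_prod I M\<^esub> y \<in> filt (filt_prod I M) n"
      by (auto simp: filt_prod_def intro!: sm(5)[OF _ _ n(1)])
  next
    show "filt (filt_prod I M) 1 = carrier (filt_prod I M)"
      using filtered_module.filt_1[OF M] by (auto simp: filt_prod_def PiE_iff)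
  next
    have I: "z \<in> (\<Inter>n\<in>{1..}. filt (M i) n) \<longleftrightarrow> z = \<zero>\<^bsub>M i\<^esub>" if "i \<in> I" for i z
      using filtered_module.filt_Inter[OF M[OF that]] by auto
    show "(\<Inter>n\<in>{1..}. filt (filt_prod I M) n) = {\<zero>\<^bsub>filt_prod I M\<^esub>}" (is "?L = ?R")
    proof
      show "?L \<subseteq> ?R"
      proof
        fix x assume x: "x \<in> ?L"
        then have "x i = \<zero>\<^bsub>M i\<^esub>" if "i \<in> I" for i using that I[OF that, of "x i"] by (auto simp: filt_prod_def PiE_iff)
        moreover have "x \<in> extensional I" using x by (auto simp: filt_prod_def PiE_iff)
        ultimately show "x \<in> ?R" by (auto simp: filt_prod_def extensional_def fun_eq_iff)
      qed
      show "?R \<subseteq> ?L" using I by (auto simp: filt_prod_def PiE_iff)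
    qed
  qed
qed

end

lemma filtered_module_filt_sum:
  assumes "filtered_module R M" "filtered_module R N"
  shows "filtered_module R (filt_sum M N)"
proof -
  interpret M: filtered_module R M by fact
  interpret N: filtered_module R N by fact
  have Rc: "cring R" using M.module_axioms by (simp add: module_def)
  note sM = M.submoduleE[OF M.filt_submodule] and sN = N.submoduleE[OF N.filt_submodule]
  have "module R (filt_sum M N)"
  proof (intro moduleI Rc abelian_groupI)
    fix x assume "x \<in> carrier (filt_sum M N)"
    then show "\<exists>y\<in>carrier (filt_sum M N). y \<oplus>\<^bsub>filt_sum M N\<^esub> x = \<zero>\<^bsub>filt_sum M N\<^esub>"
      by (intro bexI[of _ "(\<ominus>\<^bsub>M\<^esub> fst x, \<ominus>\<^bsub>N\<^esub> snd x)"]) (auto simp: filt_sum_def M.l_neg N.l_neg)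
  qed (auto simp: filt_sum_def M.a_assoc N.a_assoc M.smult_l_distr N.smult_l_distr
     M.smult_r_distr N.smult_r_distr M.smult_assoc1 N.smult_assoc1 intro: M.a_comm N.a_comm)
  then show ?thesis
  proof (rule filtered_moduleI)
    fix n :: nat assume n: "n \<ge> 1"
    have z: "\<zero>\<^bsub>M\<^esub> \<in> filt M n" "\<zero>\<^bsub>N\<^esub> \<in> filt N n"
      using M.filt_Inter N.filt_Inter n by auto
    show "filt (filt_sum M N) n \<subseteq> carrier (filt_sum M N)"
      using sM(1)[OF n] sN(1)[OF n] by (auto simp: filt_sum_def)
    show "\<zero>\<^bsub>filt_sum M N\<^esub> \<in> filt (filt_sum M N) n" using z by (simp add: filt_sum_def)
    show "filt (filt_sum M N) (Suc n) \<subseteq> filt (filt_sum M N) n"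
      using M.filt_decr[OF n] N.filt_decr[OF n] by (auto simp: filt_sum_def)
    fix a x assume "a \<in> carrier R" "x \<in> filt (filt_sum M N) n"
    then show "a \<odot>\<^bsub>filt_sum M N\<^esub> x \<in> filt (filt_sum M N) n"
      using sM(4)[OF n] sN(4)[OF n] by (auto simp: filt_sum_def)
  next
    fix n :: nat and x y assume n: "n \<ge> 1" "x \<in> filt (filt_sum M N) n" "y \<in> filt (filt_sum M N) n"
    then show "x \<oplus>\<^bsub>filt_sum M N\<^esub> y \<in> filt (filt_sum M N) n"
      using sM(5)[OF n(1)] sN(5)[OF n(1)] by (auto simp: filt_sum_def)
  next
    show "filt (filt_sum M N) 1 = carrier (filt_sum M N)"
      using M.filt_1 N.filt_1 by (auto simp: filt_sum_def)
  next
    have "(\<Inter>n\<in>{1..}. filt (filt_sum M N) n) = (\<Inter>n\<in>{1..}. filt M n) \<times> (\<Inter>n\<in>{1..}. filt N n)"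
      by (auto simp: filt_sum_def)
    then show "(\<Inter>n\<in>{1..}. filt (filt_sum M N) n) = {\<zero>\<^bsub>filt_sum M N\<^esub>}"
      unfolding M.filt_Inter N.filt_Inter by (simp add: filt_sum_def)
  qed
qed

lemma filtered_module_M_total:
  assumes "shift \<rho>" "p > 0"
  shows "filtered_module (Zp p) (M_total p \<rho> f)"
proof -
  have "i \<ge> 1" if "i \<in> T_star \<rho>" for i using that by (auto simp: T_star_def T_set_def e_star_def)
  then show ?thesis unfolding M_total_def M_rho_def M_rho_star_def
    by (intro filtered_module_filt_sum filtered_module_filt_prod filtered_module_S assms cring_Zp)
       (auto simp: T_star_def)
qed

lemma group_Aut_filt:
  assumes "filtered_module R M"
  shows "group (Aut_filt R M)"
proof -
  interpret M: filtered_module R M by fact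
  have bij: "filt_auts R M \<subseteq> Bij (carrier M)"
  proof
    fix \<phi> assume "\<phi> \<in> filt_auts R M"
    then obtain \<psi> where *: "\<phi> \<in> filt_hom R M M" "\<psi> \<in> filt_hom R M M" "\<forall>x\<in>carrier M. \<psi> (\<phi> x) = x \<and> \<phi> (\<psi> x) = x"
      by (auto simp: filt_auts_def)
    then have "bij_betw \<phi> (carrier M) (carrier M)"
      by (intro bij_betw_byWitness[of _ \<psi>]) (auto simp: filt_hom_def)
    then show "\<phi> \<in> Bij (carrier M)" using * by (auto simp: Bij_def filt_hom_def PiE_def)
  qed
  have sub: "x \<in> carrier M" if "n \<ge> 1" "x \<in> filt M n" for n x using M.submoduleE(1)[OF M.filt_submodule] that by auto
  have comp: "compose (carrier M) \<phi> \<psi> \<in> filt_hom R M M" if "\<phi> \<in> filt_hom R M M" "\<psi> \<in> filt_hom R M M" for \<phi> \<psi>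
    using that sub by (auto simp: filt_hom_def compose_def PiE_iff image_subset_iff)
  have "subgroup (filt_auts R M) (BijGroup (carrier M))"
  proof (rule group.subgroupI[OF group_BijGroup])
    show "filt_auts R M \<subseteq> carrier (BijGroup (carrier M))" using bij by (simp add: BijGroup_def)
    have "(\<lambda>x\<in>carrier M. x) \<in> filt_hom R M M" using sub by (auto simp: filt_hom_def)
    then have "(\<lambda>x\<in>carrier M. x) \<in> filt_auts R M" by (auto simp: filt_auts_def intro!: bexI[of _ "\<lambda>x\<in>carrier M. x"])
    then show "filt_auts R M \<noteq> {}" by auto
  next
    fix \<phi> assume a: "\<phi> \<in> filt_auts R M"
    then obtain \<psi> where *: "\<phi> \<in> filt_hom R M M" "\<psi> \<in> filt_hom R M M" "\<forall>x\<in>carrier M. \<psi> (\<phi> x) = x \<and> \<phi> (\<psi> x) = x"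
      by (auto simp: filt_auts_def)
    then have m: "\<psi> \<in> filt_auts R M" by (auto simp: filt_auts_def)
    have "inv\<^bsub>BijGroup (carrier M)\<^esub> \<phi> = \<psi>"
      using bij a m * by (intro group.inv_equality[OF group_BijGroup])
        (auto simp: BijGroup_def compose_def filt_hom_def intro!: restrict_ext)
    then show "inv\<^bsub>BijGroup (carrier M)\<^esub> \<phi> \<in> filt_auts R M" using m by simp
  next
    fix \<phi> \<chi> assume a: "\<phi> \<in> filt_auts R M" "\<chi> \<in> filt_auts R M"
    then obtain \<psi> where *: "\<phi> \<in> filt_hom R M M" "\<psi> \<in> filt_hom R M M" "\<forall>x\<in>carrier M. \<psi> (\<phi> x) = x \<and> \<phi> (\<psi> x) = x"
      by (auto simp: filt_auts_def)
    obtain \<omega> where o: "\<chi> \<in> filt_hom R M M" "\<omega> \<in> filt_hom R M M" "\<forall>x\<in>carrier M. \<omega> (\<chi> x) = x \<and> \<chi> (\<omega> x) = x"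
      using a by (auto simp: filt_auts_def)
    have "compose (carrier M) \<phi> \<chi> \<in> filt_auts R M"
      unfolding filt_auts_def
      by (intro CollectI conjI comp * o bexI[of _ "compose (carrier M) \<omega> \<psi>"])
         (use * o in \<open>auto simp: compose_def filt_hom_def PiE_iff\<close>)
    then show "\<phi> \<otimes>\<^bsub>BijGroup (carrier M)\<^esub> \<chi> \<in> filt_auts R M"
      using bij a by (auto simp: BijGroup_def)
  qed
  then show ?thesis unfolding Aut_filt_def
    by (rule subgroup.subgroup_is_group[OF _ group_BijGroup])
qed

lemma jump_vector_mem:
  assumes "J \<in> Jump_star \<rho>" "p > 0" "shift \<rho>"
  shows "jump_vector p \<rho> f J \<in> nat_multiples p (M_total p \<rho> f)"
proof -
  obtain I \<beta> where J: "J = (I, \<beta>)" and b: "\<And>i. i \<in> I \<Longrightarrow> \<beta> i \<ge> 1"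
    using assms by (auto simp: Jump_star_def)
  interpret Z: cring "Zp p" using cring_Zp[OF assms(2)] .
  interpret T: filtered_module "Zp p" "M_total p \<rho> f" using filtered_module_M_total assms by blast
  define y where "y = (\<lambda>j\<in>T_star \<rho>. if j \<in> I then Zp_of_nat p (p ^ (\<beta> j - 1)) else \<zero>\<^bsub>Zp p\<^esub>)"
  let ?z = "\<zero>\<^bsub>filt_prod {1..f - 1} (\<lambda>_. M_rho p \<rho>)\<^esub>"
  have y: "(?z, y) \<in> carrier (M_total p \<rho> f)"
    unfolding M_total_def filt_sum_def M_rho_star_def M_rho_def y_def filt_prod_def S_mod_def
    by (auto simp: Zp_of_nat_def Z.add.nat_pow_closed)
  have "[k] \<cdot>\<^bsub>M_total p \<rho> f\<^esub> (?z, y) = (?z, \<lambda>j\<in>T_star \<rho>. [k] \<cdot>\<^bsub>Zp p\<^esub> y j)" for k :: nat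
  proof (induction k)
    case 0 then show ?case
     by simp (simp add: M_total_def filt_sum_def M_rho_star_def filt_prod_def S_mod_def restrict_def)
  next
    case (Suc k)
    have "[Suc k] \<cdot>\<^bsub>M_total p \<rho> f\<^esub> (?z, y) = (?z, \<lambda>j\<in>T_star \<rho>. [k] \<cdot>\<^bsub>Zp p\<^esub> y j) \<oplus>\<^bsub>M_total p \<rho> f\<^esub> (?z, y)"
      using Suc by (simp add: restrict_def)
    also have "\<dots> = (?z, \<lambda>j\<in>T_star \<rho>. [Suc k] \<cdot>\<^bsub>Zp p\<^esub> y j)"
      by (auto simp: M_total_def filt_sum_def M_rho_star_def M_rho_def filt_prod_def S_mod_def intro!: restrict_ext)
    finally show ?case .
  qed
  moreover have "p ^ (\<beta> j - Suc 0) * p = p ^ \<beta> j" if "j \<in> I" for j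
    using b[OF that] power_minus_mult[of "\<beta> j" p] by simp
  ultimately have "[p] \<cdot>\<^bsub>M_total p \<rho> f\<^esub> (?z, y) = jump_vector p \<rho> f J"
    unfolding J jump_vector_def using b
    by (auto simp: y_def Zp_of_nat_def Z.add.nat_pow_pow intro!: restrict_ext)
  then show ?thesis using y unfolding nat_multiples_def by (metis imageI)
qed

end

theory Submission
  imports Defs "HOL-Number_Theory.Cong"
begin

text \<open>
  Write a vector in coordinates \<open>x a\<close>, one for each summand \<open>S (\<iota> a)\<close>, and record each nonzero
  coordinate of order b by the point \<open>(b, \<rho>^b (\<iota> a))\<close>. Order the points componentwise.

  The set generated upwards by these points is an orbit invariant: a vector lies in
  \<open>p^m M + M_n\<close>, a submodule preserved by every automorphism, iff each of its points \<open>(b, w)\<close>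
  satisfies \<open>b \<ge> m\<close> or \<open>w \<ge> n\<close> (\<open>power_plus_filt_iff\<close>).

  Extended jump sets are exactly the antichains of such points with \<open>b \<ge> 1\<close>, so each upward closed
  set arising from \<open>p M\<close> has a unique jump set of minimal points (\<open>jump_set_of_points\<close>,
  \<open>jump_upset_inj\<close>). In particular vectors of distinct jump sets lie in distinct orbits.

  Conversely a vector can be moved to the vector of its jump set. If \<open>(b, w)\<close>, coming from the
  coordinate d, lies below \<open>(b', w')\<close>, then \<open>S (\<iota> d)\<close> is mapped into the other summand by
  multiples of \<open>p^(b' - b)\<close>, because \<open>\<rho>^b (\<iota> d) \<le> \<rho>^b' i\<close> can be cancelled to
  \<open>\<iota> d \<le> \<rho>^(b' - b) i\<close>. Adding such a multiple of the coordinate d changes the other coordinate by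
  an arbitrary element of order at least \<open>b'\<close> (\<open>change_coordinate\<close>). Hence the minimal points can be
  placed in the preferred summand of their weight with coordinate exactly \<open>p^b\<close>, and all further
  coordinates can then be cleared against them (\<open>fix_one_coordinate\<close>).

  Every orbit in \<open>p M\<close> thus contains exactly one vector of a jump set, which is both the existence
  and the uniqueness of the map.
\<close>

section \<open>Divisibility in the p-adic integers\<close>

lemma Zp_simps:
  "\<zero>\<^bsub>Zp p\<^esub> = (\<lambda>n. 0)"
  "(x \<oplus>\<^bsub>Zp p\<^esub> y) n = (x n + y n) mod int p ^ n"
  "(x \<otimes>\<^bsub>Zp p\<^esub> y) n = (x n * y n) mod int p ^ n"
  "\<one>\<^bsub>Zp p\<^esub> n = 1 mod int p ^ n"
  by (simp_all add: Zp_def)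

lemma Zp_of_nat_closed: "p > 0 \<Longrightarrow> Zp_of_nat p k \<in> carrier (Zp p)"
  using Zp_I[of p "\<lambda>_. int k"] by (simp add: Zp_of_nat_eq)

lemma Zp_of_nat_power_vanish_iff:
  assumes "p > 1"
  shows "Zp_of_nat p (p ^ b) n = 0 \<longleftrightarrow> n \<le> b"
  using assms by (simp add: Zp_of_nat_eq dvd_power_iff_le flip: of_nat_power dvd_eq_mod_eq_0)

lemma Zp_mult_vanish:
  assumes x: "x \<in> carrier (Zp p)" "x k = 0" and y: "y \<in> carrier (Zp p)" "y l = 0"
  shows "(x \<otimes>\<^bsub>Zp p\<^esub> y) (k + l) = 0"
proof -
  have "int p ^ k dvd x (k + l)" using Zp_coherent[OF x(1), of k l] x(2) by (simp add: mod_0_imp_dvd)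
  moreover have "int p ^ l dvd y (k + l)"
    using Zp_coherent[OF y(1), of l k] y(2) by (simp add: mod_0_imp_dvd add.commute)
  ultimately have "int p ^ (k + l) dvd x (k + l) * y (k + l)" by (simp add: power_add mult_dvd_mono)
  then show ?thesis by (simp add: Zp_simps)
qed

lemma Zp_ord_eqI:
  assumes "x \<in> carrier (Zp p)" "p > 0" "x b = 0" "x (Suc b) \<noteq> 0"
  shows "Zp_ord p x = b"
proof -
  have "x \<noteq> \<zero>\<^bsub>Zp p\<^esub>" using assms(4) by (auto simp: Zp_simps)
  then show ?thesis
    using Zp_ord_ge_iff[OF assms(1,2), of b] Zp_ord_ge_iff[OF assms(1,2), of "Suc b"] assms(3,4) by auto
qed

lemma Zp_ord_vanish:
  assumes "x \<in> carrier (Zp p)" "p > 0" "x \<noteq> \<zero>\<^bsub>Zp p\<^esub>"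
  shows "x (Zp_ord p x) = 0" "x (Suc (Zp_ord p x)) \<noteq> 0"
  using Zp_ord_ge_iff[OF assms, of "Zp_ord p x"] Zp_ord_ge_iff[OF assms, of "Suc (Zp_ord p x)"] by auto

text \<open>
  An inverse modulo each power of p is unique modulo that power, so these inverses are coherent.
\<close>

lemma Zp_unit:
  assumes p: "Factorial_Ring.prime p" and x: "x \<in> carrier (Zp p)" "x 1 \<noteq> 0"
  shows "\<exists>y\<in>carrier (Zp p). x \<otimes>\<^bsub>Zp p\<^esub> y = \<one>\<^bsub>Zp p\<^esub>"
proof -
  have p0: "p > 0" using p prime_gt_0_nat by blast
  have cop: "coprime (x n) (int p ^ n)" for n
  proof (cases n)
    case (Suc k)
    have "x n mod int p = x 1" using Zp_coherent[OF x(1), of 1 k] Suc by simp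
    then have "\<not> int p dvd x n" using x(2) by auto
    moreover have "Factorial_Ring.prime (int p)" using p by simp
    ultimately have "coprime (int p) (x n)" by (rule prime_imp_coprime[rotated])
    then show ?thesis by (simp add: coprime_commute)
  qed simp
  have "\<exists>g. [x n * g = 1] (mod int p ^ n)" for n
    using cong_solve_coprime_int[OF cop[of n]] .
  then obtain g where g: "\<And>n. [x n * g n = 1] (mod int p ^ n)" by metis
  have "g (Suc n) mod int p ^ n = g n mod int p ^ n" for n
  proof -
    have "[x (Suc n) * g (Suc n) = 1] (mod int p ^ n)"
      by (rule cong_dvd_modulus[OF g]) simp
    moreover have "[x (Suc n) = x n] (mod int p ^ n)"
      using Zp_Suc[OF x(1)] Zp_mod_self[OF x(1)] by (simp add: cong_def)
    ultimately have "[x n * g (Suc n) = 1] (mod int p ^ n)"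
      by (meson cong_scalar_right cong_sym cong_trans)
    then have "[x n * g (Suc n) = x n * g n] (mod int p ^ n)"
      using g cong_sym cong_trans by blast
    then show ?thesis
      using cong_mult_lcancel[OF cop] unfolding cong_def by blast
  qed
  then have "(\<lambda>n. g n mod int p ^ n) \<in> carrier (Zp p)" by (rule Zp_I[OF p0])
  moreover have "x \<otimes>\<^bsub>Zp p\<^esub> (\<lambda>n. g n mod int p ^ n) = \<one>\<^bsub>Zp p\<^esub>"
    using g by (simp add: fun_eq_iff Zp_simps mod_mult_right_eq cong_def)
  ultimately show ?thesis by blast
qed

text \<open>
  A cofactor of \<open>p^b\<close> that vanished modulo p would make x vanish modulo \<open>p^(b + 1)\<close>.
\<close>

lemma Zp_decomp:
  assumes p: "Factorial_Ring.prime p" and x: "x \<in> carrier (Zp p)" "x b = 0" "x (Suc b) \<noteq> 0"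
  shows "\<exists>u\<in>Units (Zp p). x = Zp_of_nat p (p ^ b) \<otimes>\<^bsub>Zp p\<^esub> u"
proof -
  have p0: "p > 0" using p prime_gt_0_nat by blast
  interpret cring "Zp p" using cring_Zp[OF p0] .
  obtain u where u: "u \<in> carrier (Zp p)" "x = Zp_of_nat p (p ^ b) \<otimes>\<^bsub>Zp p\<^esub> u"
    using Zp_divides_iff[OF x(1) p0, of b] x(2) by (auto simp: factor_def)
  have "u 1 \<noteq> 0"
    using Zp_mult_vanish[OF Zp_of_nat_closed[OF p0], of "p ^ b" b u 1] u x(3)
      Zp_of_nat_power_vanish_iff[of p b b] prime_gt_1_nat[OF p] by auto
  then obtain w where "w \<in> carrier (Zp p)" "u \<otimes>\<^bsub>Zp p\<^esub> w = \<one>\<^bsub>Zp p\<^esub>"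
    using Zp_unit[OF p u(1)] by blast
  then have "u \<in> Units (Zp p)" using u(1) by (auto simp: Units_def m_comm intro!: bexI[of _ w])
  then show ?thesis using u(2) by blast
qed

text \<open>
  The quotients by which one coordinate is cleared against another. Their divisibility by \<open>p^k\<close> is
  what makes multiplication by them respect the filtrations.
\<close>

lemma Zp_quotient:
  assumes p: "Factorial_Ring.prime p" and x: "x \<in> carrier (Zp p)" "x b = 0" "x (Suc b) \<noteq> 0"
    and z: "z \<in> carrier (Zp p)" "z (b + k) = 0"
  shows "\<exists>r\<in>carrier (Zp p). r k = 0 \<and> r \<otimes>\<^bsub>Zp p\<^esub> x = z"
proof -
  have p0: "p > 0" using p prime_gt_0_nat by blast
  interpret cring "Zp p" using cring_Zp[OF p0] .
  obtain u where u: "u \<in> Units (Zp p)" "x = Zp_of_nat p (p ^ b) \<otimes>\<^bsub>Zp p\<^esub> u"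
    using Zp_decomp[OF p x] by blast
  obtain y where y: "y \<in> carrier (Zp p)" "z = Zp_of_nat p (p ^ (b + k)) \<otimes>\<^bsub>Zp p\<^esub> y"
    using Zp_divides_iff[OF z(1) p0, of "b + k"] z(2) by (auto simp: factor_def)
  have c [simp]: "u \<in> carrier (Zp p)" "inv\<^bsub>Zp p\<^esub> u \<in> carrier (Zp p)"
      "Zp_of_nat p m \<in> carrier (Zp p)" for m
    using u(1) Zp_of_nat_closed[OF p0] by auto
  have pk: "Zp_of_nat p (p ^ (b + k)) = Zp_of_nat p (p ^ b) \<otimes>\<^bsub>Zp p\<^esub> Zp_of_nat p (p ^ k)"
    by (simp add: Zp_of_nat_eq fun_eq_iff Zp_simps mod_mult_eq power_add)
  define r where "r = Zp_of_nat p (p ^ k) \<otimes>\<^bsub>Zp p\<^esub> (inv\<^bsub>Zp p\<^esub> u \<otimes>\<^bsub>Zp p\<^esub> y)"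
  have rc: "r \<in> carrier (Zp p)" using y by (simp add: r_def)
  have "r k = 0"
    using Zp_divides_iff[OF rc p0, of k] y(1) unfolding r_def by (auto simp: factor_def)
  moreover have "r \<otimes>\<^bsub>Zp p\<^esub> x = z \<otimes>\<^bsub>Zp p\<^esub> (inv\<^bsub>Zp p\<^esub> u \<otimes>\<^bsub>Zp p\<^esub> u)"
    unfolding r_def u(2) y(2) pk using y(1) by (simp add: m_ac)
  ultimately show ?thesis using rc u(1) z(1) by (auto simp: Units_l_inv)
qed

text \<open>
  Replaces the order of x by a witness k, so that the zero vector needs no separate case in
  arguments about sums and products.
\<close>

lemma S_filt_iff:
  assumes "shift \<rho>" "i \<ge> 1" "p > 0"
  shows "x \<in> filt (S_mod p \<rho> i) n \<longleftrightarrow> x \<in> carrier (Zp p) \<and> (\<exists>k. n \<le> (\<rho> ^^ k) i \<and> x k = 0)"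
proof (cases "x \<in> carrier (Zp p) \<and> x \<noteq> \<zero>\<^bsub>Zp p\<^esub>")
  case True
  then have x: "x \<in> carrier (Zp p)" "x \<noteq> \<zero>\<^bsub>Zp p\<^esub>" by auto
  show ?thesis
    using x Zp_ord_vanish(1)[OF x(1) assms(3) x(2)] Zp_ord_ge_iff[OF x(1) assms(3) x(2)]
      shift_pow_mono[OF assms(1,2)]
    by (auto simp: S_mod_def S_weight_def intro: order_trans)
next
  case False
  moreover have "n \<le> (\<rho> ^^ n) i" using shift_pow[OF assms(1,2), of n] by simp
  ultimately show ?thesis by (auto simp: S_mod_def S_weight_def Zp_simps)
qed


section \<open>Jump sets as antichains\<close>

lemma T_star_ge_1: "i \<in> T_star \<rho> \<Longrightarrow> 1 \<le> i"
  by (auto simp: T_star_def T_set_def e_star_def)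

lemma shift_pow_strict_mono:
  assumes "shift \<rho>" "1 \<le> i" "i < j"
  shows "(\<rho> ^^ l) i < (\<rho> ^^ l) j"
proof (induction l)
  case (Suc l)
  have "1 \<le> (\<rho> ^^ l) i" "1 \<le> (\<rho> ^^ l) j"
    using shift_pow[OF assms(1), of i l] shift_pow[OF assms(1), of j l] assms(2,3) by linarith+
  then show ?case using Suc assms(1) by (auto simp: shift_def strict_mono_on_def)
qed (use assms in simp)

lemma shift_pow_le_iff:
  assumes "shift \<rho>" "1 \<le> i" "1 \<le> j"
  shows "(\<rho> ^^ l) i \<le> (\<rho> ^^ l) j \<longleftrightarrow> i \<le> j"
  using shift_pow_strict_mono[OF assms(1,2), of j l] shift_pow_strict_mono[OF assms(1,3), of i l]
  by (cases i j rule: linorder_cases) auto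

text \<open>
  Comparing two points of the plane amounts to asking whether \<open>p^k\<close> times the generator of weight
  j is deep enough in the filtration to receive the generator of weight i.
\<close>

lemma shift_pow_cancel:
  assumes "shift \<rho>" "1 \<le> i" "1 \<le> j" "(\<rho> ^^ b) i \<le> (\<rho> ^^ (b + k)) j"
  shows "i \<le> (\<rho> ^^ k) j"
  using assms(4) shift_pow[OF assms(1,3), of k] assms(3) shift_pow_le_iff[OF assms(1,2), of "(\<rho> ^^ k) j" b]
  by (simp add: funpow_add)

lemma Jump_star_antichain:
  assumes "(I, \<beta>) \<in> Jump_star \<rho>" "i \<in> I" "j \<in> I" "\<beta> i \<le> \<beta> j" "(\<rho> ^^ \<beta> i) i \<le> (\<rho> ^^ \<beta> j) j"
  shows "i = j"
proof (cases i j rule: linorder_cases)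
  case less
  then have "\<beta> j < \<beta> i" using assms(1-3) by (auto simp: Jump_star_def monotone_on_def)
  then show ?thesis using assms(4) by simp
next
  case greater
  then have "(\<rho> ^^ \<beta> j) j < (\<rho> ^^ \<beta> i) i" using assms(1-3) by (auto simp: Jump_star_def monotone_on_def)
  then show ?thesis using assms(5) by simp
qed

text \<open>
  Stands in for J because the corresponding region of a vector can be read off from submodules that
  all automorphisms preserve.
\<close>

definition jump_upset :: "(nat \<Rightarrow> nat) \<Rightarrow> nat set \<times> (nat \<Rightarrow> nat) \<Rightarrow> (nat \<times> nat) set" where
  "jump_upset \<rho> J = {(m, n). \<exists>i\<in>fst J. snd J i \<le> m \<and> (\<rho> ^^ snd J i) i \<le> n}"

text \<open>
  The weight \<open>\<rho>^b j\<close> together with b determines j, since \<open>\<rho>\<close> is injective; so a point which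
  coincides with a minimal one has the same index.
\<close>

lemma jump_upset_minimal:
  assumes J: "(I, \<beta>) \<in> Jump_star \<rho>" and "shift \<rho>" and i: "i \<in> I" and j: "1 \<le> j"
    and up: "(b, (\<rho> ^^ b) j) \<in> jump_upset \<rho> (I, \<beta>)" and le: "b \<le> \<beta> i" "(\<rho> ^^ b) j \<le> (\<rho> ^^ \<beta> i) i"
  shows "j = i \<and> b = \<beta> i"
proof -
  obtain k where k: "k \<in> I" "\<beta> k \<le> b" "(\<rho> ^^ \<beta> k) k \<le> (\<rho> ^^ b) j"
    using up by (auto simp: jump_upset_def)
  then have "k = i" using Jump_star_antichain[OF J k(1) i] le by linarith
  then have b: "b = \<beta> i" "(\<rho> ^^ b) j = (\<rho> ^^ b) i" using k le by auto
  have "1 \<le> i" using J i T_star_ge_1 by (auto simp: Jump_star_def)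
  then have "j = i" using shift_pow_le_iff[OF assms(2)] b(2) j by (metis le_antisym order_refl)
  then show ?thesis using b by simp
qed

lemma jump_upset_subset:
  assumes J: "(I, \<beta>) \<in> Jump_star \<rho>" and J': "(I', \<beta>') \<in> Jump_star \<rho>" and "shift \<rho>"
    and eq: "jump_upset \<rho> (I, \<beta>) = jump_upset \<rho> (I', \<beta>')" and i: "i \<in> I"
  shows "i \<in> I' \<and> \<beta>' i = \<beta> i"
proof -
  have "(\<beta> i, (\<rho> ^^ \<beta> i) i) \<in> jump_upset \<rho> (I', \<beta>')"
    unfolding eq[symmetric] using i by (auto simp: jump_upset_def)
  then obtain j where j: "j \<in> I'" "\<beta>' j \<le> \<beta> i" "(\<rho> ^^ \<beta>' j) j \<le> (\<rho> ^^ \<beta> i) i"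
    by (auto simp: jump_upset_def)
  then have "(\<beta>' j, (\<rho> ^^ \<beta>' j) j) \<in> jump_upset \<rho> (I, \<beta>)" unfolding eq by (auto simp: jump_upset_def)
  moreover have "1 \<le> j" using J' j(1) T_star_ge_1 by (auto simp: Jump_star_def)
  ultimately show ?thesis using jump_upset_minimal[OF J assms(3) i, of j "\<beta>' j"] j by auto
qed

text \<open>
  An antichain is the set of minimal elements of the upward closed set that it generates.
\<close>

lemma jump_upset_inj:
  assumes "shift \<rho>" "J \<in> Jump_star \<rho>" "J' \<in> Jump_star \<rho>" "jump_upset \<rho> J = jump_upset \<rho> J'"
  shows "J = J'"
proof -
  obtain I \<beta> I' \<beta>' where JJ: "J = (I, \<beta>)" "J' = (I', \<beta>')" by fastforce
  note s = jump_upset_subset[OF assms(2,3)[unfolded JJ] assms(1) assms(4)[unfolded JJ]]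
    jump_upset_subset[OF assms(3,2)[unfolded JJ] assms(1) assms(4)[symmetric, unfolded JJ]]
  then have I: "I = I'" by blast
  have "\<beta> \<in> extensional I" "\<beta>' \<in> extensional I"
    using assms(2,3) JJ I by (auto simp: Jump_star_def PiE_def)
  then have "\<beta> = \<beta>'" by (rule extensionalityI) (metis s(1))
  then show ?thesis using I JJ by simp
qed

text \<open>
  Take the minimal points. There is at most one of them for each i, because \<open>b \<mapsto> \<rho>^b i\<close> is
  increasing. For \<open>i < j\<close>, an inequality \<open>\<beta> i \<le> \<beta> j\<close> would give
  \<open>\<rho>^(\<beta> i) i \<le> \<rho>^(\<beta> j) i < \<rho>^(\<beta> j) j\<close> and make j non-minimal. So \<open>\<beta>\<close> decreases, and
  incomparability makes the weights increase.
\<close>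

lemma jump_set_of_points:
  assumes \<rho>: "shift \<rho>" and fin: "finite (T_set \<rho>)" and P: "P \<subseteq> T_star \<rho> \<times> {1..}"
  shows "\<exists>J\<in>Jump_star \<rho>. jump_upset \<rho> J = {(m, n). \<exists>(i, b)\<in>P. b \<le> m \<and> (\<rho> ^^ b) i \<le> n}"
proof -
  define minimal where "minimal = (\<lambda>(i, b). (i, b) \<in> P \<and>
    (\<forall>(j, c)\<in>P. c \<le> b \<and> (\<rho> ^^ c) j \<le> (\<rho> ^^ b) i \<longrightarrow> j = i \<and> c = b))"
  have inj: "i = j" if "(i, b) \<in> P" "(j, b) \<in> P" "(\<rho> ^^ b) i = (\<rho> ^^ b) j" for i j b
    using shift_pow_le_iff[OF \<rho>, of i j b] shift_pow_le_iff[OF \<rho>, of j i b] that P T_star_ge_1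
    by fastforce
  \<comment> \<open>Descent on the sum of the two components, which drops at every smaller point.\<close>
  have below: "\<exists>j c. minimal (j, c) \<and> c \<le> b \<and> (\<rho> ^^ c) j \<le> (\<rho> ^^ b) i" if "(i, b) \<in> P" for i b
    using that
  proof (induction "b + (\<rho> ^^ b) i" arbitrary: i b rule: less_induct)
    case less
    show ?case
    proof (cases "minimal (i, b)")
      case False
      then obtain j c where jc: "(j, c) \<in> P" "c \<le> b" "(\<rho> ^^ c) j \<le> (\<rho> ^^ b) i" "\<not> (j = i \<and> c = b)"
        using less.prems by (auto simp: minimal_def)
      have "c + (\<rho> ^^ c) j \<noteq> b + (\<rho> ^^ b) i"
      proof
        assume "c + (\<rho> ^^ c) j = b + (\<rho> ^^ b) i"
        then have cb: "c = b" "(\<rho> ^^ c) j = (\<rho> ^^ b) i" using jc(2,3) by linarith+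
        have "j = i" by (rule inj[OF _ less.prems]) (use jc(1) cb in simp_all)
        then show False using jc(4) cb(1) by blast
      qed
      then have "c + (\<rho> ^^ c) j < b + (\<rho> ^^ b) i" using jc by linarith
      from less.hyps[OF this jc(1)] obtain k d
        where "minimal (k, d)" "d \<le> c" "(\<rho> ^^ d) k \<le> (\<rho> ^^ c) j" by blast
      then show ?thesis using jc(2,3) by (meson order_trans)
    qed auto
  qed
  define I where "I = {i. \<exists>b. minimal (i, b)}"
  define \<beta> where "\<beta> = (\<lambda>i\<in>I. SOME b. minimal (i, b))"
  have same: "b = c" if "minimal (i, b)" "minimal (i, c)" for i b c
  proof -
    have "1 \<le> i" using that P T_star_ge_1 by (auto simp: minimal_def)
    then have "c \<le> b \<and> (\<rho> ^^ c) i \<le> (\<rho> ^^ b) i \<or> b \<le> c \<and> (\<rho> ^^ b) i \<le> (\<rho> ^^ c) i"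
      using shift_pow_mono[OF \<rho>, of i] by (meson nat_le_linear)
    then show ?thesis using that by (auto simp: minimal_def)
  qed
  have \<beta>: "minimal (i, b) \<longleftrightarrow> i \<in> I \<and> b = \<beta> i" for i b
  proof -
    have "minimal (i, \<beta> i)" if "i \<in> I"
      using that someI_ex[of "\<lambda>b. minimal (i, b)"] by (auto simp: \<beta>_def I_def)
    moreover have "i \<in> I" if "minimal (i, b)" using that by (auto simp: I_def)
    ultimately show ?thesis using same by blast
  qed
  have min: "minimal (i, \<beta> i)" if "i \<in> I" for i using \<beta> that by blast
  then have inP: "(i, \<beta> i) \<in> P" if "i \<in> I" for i using that by (auto simp: minimal_def)
  have IT: "I \<subseteq> T_star \<rho>" and \<beta>1: "\<And>i. i \<in> I \<Longrightarrow> 1 \<le> \<beta> i" using inP P by auto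
  have anti: "i = j" if "i \<in> I" "j \<in> I" "\<beta> i \<le> \<beta> j" "(\<rho> ^^ \<beta> i) i \<le> (\<rho> ^^ \<beta> j) j" for i j
    using min[OF that(2)] inP[OF that(1)] that(3,4) by (auto simp: minimal_def)
  have order: "\<beta> j < \<beta> i \<and> (\<rho> ^^ \<beta> i) i < (\<rho> ^^ \<beta> j) j" if "i \<in> I" "j \<in> I" "i < j" for i j
  proof -
    have i1: "1 \<le> i" using IT that T_star_ge_1 by auto
    have "\<beta> j < \<beta> i"
    proof (rule ccontr)
      assume "\<not> \<beta> j < \<beta> i"
      then have le: "\<beta> i \<le> \<beta> j" by simp
      have "(\<rho> ^^ \<beta> i) i \<le> (\<rho> ^^ \<beta> j) i" by (rule shift_pow_mono[OF \<rho> i1 le])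
      also have "\<dots> \<le> (\<rho> ^^ \<beta> j) j" using shift_pow_strict_mono[OF \<rho> i1 that(3)] less_imp_le by blast
      finally show False using anti[OF that(1,2) le] that(3) by simp
    qed
    moreover from this have "\<not> (\<rho> ^^ \<beta> j) j \<le> (\<rho> ^^ \<beta> i) i" using anti[OF that(2,1)] that(3) by auto
    ultimately show ?thesis by simp
  qed
  have "finite I" using IT fin by (auto simp: T_star_def intro: finite_subset)
  then have "(I, \<beta>) \<in> Jump_star \<rho>"
    using IT \<beta>1 order by (auto simp: Jump_star_def monotone_on_def \<beta>_def)
  moreover have "jump_upset \<rho> (I, \<beta>) = {(m, n). \<exists>(i, b)\<in>P. b \<le> m \<and> (\<rho> ^^ b) i \<le> n}" (is "?L = ?R")
  proof
    show "?L \<subseteq> ?R" using inP by (fastforce simp: jump_upset_def)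
    show "?R \<subseteq> ?L"
    proof clarify
      fix m n i b assume ib: "(i, b) \<in> P" "b \<le> m" "(\<rho> ^^ b) i \<le> n"
      obtain j c where "minimal (j, c)" "c \<le> b" "(\<rho> ^^ c) j \<le> (\<rho> ^^ b) i" using below[OF ib(1)] by blast
      then show "(m, n) \<in> ?L" using ib \<beta> by (auto simp: jump_upset_def intro!: bexI[of _ j])
    qed
  qed
  ultimately show ?thesis by blast
qed

section \<open>Filtered modules with coordinates\<close>

text \<open>
  A basis of a direct sum of modules S(i), given by its coordinate functions rather than as a
  concrete direct sum: several summands may share the weight \<open>\<iota> a = i\<close>, and \<open>\<sigma>\<close> picks one of
  them for each weight.
\<close>

locale weighted_coordinates = filtered_module "Zp p" M
  for p :: nat and M :: "(nat \<Rightarrow> int, 'm, 'x) filtered_module_scheme" +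
  fixes \<rho> :: "nat \<Rightarrow> nat" and A :: "'a set" and \<iota> :: "'a \<Rightarrow> nat" and \<sigma> :: "nat \<Rightarrow> 'a"
    and c :: "'a \<Rightarrow> 'm \<Rightarrow> nat \<Rightarrow> int"
  assumes prime: "Factorial_Ring.prime p"
    and shift: "shift \<rho>"
    and T_fin: "finite (T_set \<rho>)"
    and A_fin: "finite A"
    and \<iota>: "a \<in> A \<Longrightarrow> \<iota> a \<in> T_star \<rho>"
    and \<sigma>: "i \<in> T_star \<rho> \<Longrightarrow> \<sigma> i \<in> A" "i \<in> T_star \<rho> \<Longrightarrow> \<iota> (\<sigma> i) = i"
    and c_closed: "\<And>a x. \<lbrakk>a \<in> A; x \<in> carrier M\<rbrakk> \<Longrightarrow> c a x \<in> carrier (Zp p)"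
    and c_ext: "\<And>x y. \<lbrakk>x \<in> carrier M; y \<in> carrier M; \<And>a. a \<in> A \<Longrightarrow> c a x = c a y\<rbrakk> \<Longrightarrow> x = y"
    and c_surj: "\<And>g. g \<in> A \<rightarrow> carrier (Zp p) \<Longrightarrow> \<exists>x\<in>carrier M. \<forall>a\<in>A. c a x = g a"
    and c_add: "\<And>a x y. \<lbrakk>a \<in> A; x \<in> carrier M; y \<in> carrier M\<rbrakk> \<Longrightarrow>
      c a (x \<oplus>\<^bsub>M\<^esub> y) = c a x \<oplus>\<^bsub>Zp p\<^esub> c a y"
    and c_smult: "\<And>a r x. \<lbrakk>a \<in> A; r \<in> carrier (Zp p); x \<in> carrier M\<rbrakk> \<Longrightarrow>
      c a (r \<odot>\<^bsub>M\<^esub> x) = r \<otimes>\<^bsub>Zp p\<^esub> c a x"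
    and filt_iff: "\<And>n x. n \<ge> 1 \<Longrightarrow> x \<in> filt M n \<longleftrightarrow>
      x \<in> carrier M \<and> (\<forall>a\<in>A. c a x \<in> filt (S_mod p \<rho> (\<iota> a)) n)"
begin

lemma p_pos: "p > 0" and p_gt_1: "p > 1"
  using prime prime_gt_0_nat prime_gt_1_nat by blast+

lemma \<iota>_ge_1: "a \<in> A \<Longrightarrow> 1 \<le> \<iota> a"
  using \<iota> T_star_ge_1 by blast

lemma filt_closed: "n \<ge> 1 \<Longrightarrow> x \<in> filt M n \<Longrightarrow> x \<in> carrier M"
  using filt_iff by blast

lemma c_zero: "a \<in> A \<Longrightarrow> c a \<zero>\<^bsub>M\<^esub> = \<zero>\<^bsub>Zp p\<^esub>"
  using c_add[of a "\<zero>\<^bsub>M\<^esub>" "\<zero>\<^bsub>M\<^esub>"] c_closed[of a "\<zero>\<^bsub>M\<^esub>"] by simp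

definition vector :: "('a \<Rightarrow> nat \<Rightarrow> int) \<Rightarrow> 'm" where
  "vector g = (SOME x. x \<in> carrier M \<and> (\<forall>a\<in>A. c a x = g a))"

lemma vector:
  assumes "\<And>a. a \<in> A \<Longrightarrow> g a \<in> carrier (Zp p)"
  shows "vector g \<in> carrier M" "a \<in> A \<Longrightarrow> c a (vector g) = g a"
proof -
  have "\<exists>x. x \<in> carrier M \<and> (\<forall>a\<in>A. c a x = g a)" using c_surj[of g] assms by blast
  from someI_ex[OF this] show "vector g \<in> carrier M" "a \<in> A \<Longrightarrow> c a (vector g) = g a"
    by (auto simp: vector_def)
qed


subsection \<open>Transvections\<close>

definition transvection :: "'a \<Rightarrow> 'a \<Rightarrow> (nat \<Rightarrow> int) \<Rightarrow> 'm \<Rightarrow> 'm" where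
  "transvection a d r = (\<lambda>x\<in>carrier M.
     vector (\<lambda>b. if b = a then c a x \<oplus>\<^bsub>Zp p\<^esub> r \<otimes>\<^bsub>Zp p\<^esub> c d x else c b x))"

lemma transvection:
  assumes "a \<in> A" "d \<in> A" "r \<in> carrier (Zp p)" "x \<in> carrier M"
  shows "transvection a d r x \<in> carrier M"
    and "b \<in> A \<Longrightarrow> c b (transvection a d r x) =
      (if b = a then c a x \<oplus>\<^bsub>Zp p\<^esub> r \<otimes>\<^bsub>Zp p\<^esub> c d x else c b x)"
  using vector[of "\<lambda>b. if b = a then c a x \<oplus>\<^bsub>Zp p\<^esub> r \<otimes>\<^bsub>Zp p\<^esub> c d x else c b x"] c_closed assms
  by (auto simp: transvection_def)

text \<open>
  The hypotheses on \<open>r\<close> say that multiplication by \<open>r\<close> is a morphism from the summand of index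
  \<open>d\<close> to that of index \<open>a\<close>.
\<close>

lemma transvection_hom:
  assumes a: "a \<in> A" and d: "d \<in> A" and r: "r \<in> carrier (Zp p)" "r k = 0" "\<iota> d \<le> (\<rho> ^^ k) (\<iota> a)"
  shows "transvection a d r \<in> filt_hom (Zp p) M M"
  unfolding filt_hom_def
proof (intro CollectI conjI ballI allI impI)
  note t = transvection[OF a d r(1)]
  note cl = c_closed[OF a] c_closed[OF d] c_closed r(1)
  show "transvection a d r \<in> carrier M \<rightarrow>\<^sub>E carrier M"
    using t(1) by (auto simp: transvection_def)
  fix x assume x: "x \<in> carrier M"
  {
    fix y assume y: "y \<in> carrier M"
    have xy: "x \<oplus>\<^bsub>M\<^esub> y \<in> carrier M" using x y by simp
    show "transvection a d r (x \<oplus>\<^bsub>M\<^esub> y) = transvection a d r x \<oplus>\<^bsub>M\<^esub> transvection a d r y"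
    proof (rule c_ext)
      fix b assume b: "b \<in> A"
      show "c b (transvection a d r (x \<oplus>\<^bsub>M\<^esub> y)) =
        c b (transvection a d r x \<oplus>\<^bsub>M\<^esub> transvection a d r y)"
        using x y xy a d b cl by (simp add: t c_add R.r_distr R.a_ac)
    qed (use x y xy t(1) in auto)
  next
    fix s assume s: "s \<in> carrier (Zp p)"
    have sx: "s \<odot>\<^bsub>M\<^esub> x \<in> carrier M" using x s by simp
    show "transvection a d r (s \<odot>\<^bsub>M\<^esub> x) = s \<odot>\<^bsub>M\<^esub> transvection a d r x"
    proof (rule c_ext)
      fix b assume b: "b \<in> A"
      show "c b (transvection a d r (s \<odot>\<^bsub>M\<^esub> x)) = c b (s \<odot>\<^bsub>M\<^esub> transvection a d r x)"
        using x s sx a d b cl by (simp add: t c_smult R.r_distr R.m_ac)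
    qed (use x s sx t(1) in auto)
  }
next
  fix n :: nat assume n: "n \<ge> 1"
  show "transvection a d r ` filt M n \<subseteq> filt M n"
  proof
    fix y assume "y \<in> transvection a d r ` filt M n"
    then obtain x where x: "x \<in> filt M n" "y = transvection a d r x" by blast
    have xM: "x \<in> carrier M" using x n filt_closed by blast
    have xf: "c b x \<in> filt (S_mod p \<rho> (\<iota> b)) n" if "b \<in> A" for b
      using x(1) n that by (simp add: filt_iff)
    have "r \<otimes>\<^bsub>Zp p\<^esub> c d x \<in> filt (S_mod p \<rho> (\<iota> a)) n"
    proof -
      obtain l where l: "n \<le> (\<rho> ^^ l) (\<iota> d)" "c d x l = 0"
        using xf[OF d] S_filt_iff[OF shift \<iota>_ge_1[OF d] p_pos] by blast
      have "1 \<le> (\<rho> ^^ k) (\<iota> a)" using r(3) \<iota>_ge_1[OF d] by simp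
      then have "(\<rho> ^^ l) (\<iota> d) \<le> (\<rho> ^^ (l + k)) (\<iota> a)"
        using r(3) shift_pow_le_iff[OF shift \<iota>_ge_1[OF d]] by (simp add: funpow_add)
      moreover have "(r \<otimes>\<^bsub>Zp p\<^esub> c d x) (k + l) = 0"
        using Zp_mult_vanish[OF r(1,2) c_closed[OF d xM] l(2)] .
      ultimately show ?thesis
        using l(1) r(1) c_closed[OF d xM]
        unfolding S_filt_iff[OF shift \<iota>_ge_1[OF a] p_pos]
        by (metis R.m_closed add.commute order_trans)
    qed
    moreover have "submodule (filt (S_mod p \<rho> (\<iota> a)) n) (Zp p) (S_mod p \<rho> (\<iota> a))"
      using filtered_module.filt_submodule[OF filtered_module_S[OF shift \<iota>_ge_1[OF a] p_pos] n] .
    ultimately have "c a x \<oplus>\<^bsub>Zp p\<^esub> r \<otimes>\<^bsub>Zp p\<^esub> c d x \<in> filt (S_mod p \<rho> (\<iota> a)) n"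
      using subgroup.m_closed[OF submodule.axioms(1)] xf[OF a]
      by (fastforce simp: S_mod_def)
    then show "y \<in> filt M n"
      using transvection[OF a d r(1) xM] xf x(2) n by (simp add: filt_iff)
  qed
qed

text \<open>
  The hypothesis on r and s is \<open>(1 + s)(1 + r) = 1\<close> for the scaling \<open>a = d\<close> and \<open>s = - r\<close> otherwise.
\<close>

lemma transvection_inverse:
  assumes "a \<in> A" "d \<in> A" "r \<in> carrier (Zp p)" "s \<in> carrier (Zp p)" "x \<in> carrier M"
    and inverse: "s \<oplus>\<^bsub>Zp p\<^esub> r \<oplus>\<^bsub>Zp p\<^esub> (if a = d then s \<otimes>\<^bsub>Zp p\<^esub> r else \<zero>\<^bsub>Zp p\<^esub>) = \<zero>\<^bsub>Zp p\<^esub>"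
  shows "transvection a d s (transvection a d r x) = x"
proof (rule c_ext)
  note t = transvection[OF assms(1,2)]
  note cl = c_closed[OF assms(1) assms(5)] c_closed[OF assms(2) assms(5)] assms(3,4)
  fix b assume b: "b \<in> A"
  have "c a x \<oplus>\<^bsub>Zp p\<^esub> r \<otimes>\<^bsub>Zp p\<^esub> c d x \<oplus>\<^bsub>Zp p\<^esub>
      s \<otimes>\<^bsub>Zp p\<^esub> (if d = a then c a x \<oplus>\<^bsub>Zp p\<^esub> r \<otimes>\<^bsub>Zp p\<^esub> c d x else c d x) =
    c a x \<oplus>\<^bsub>Zp p\<^esub> (s \<oplus>\<^bsub>Zp p\<^esub> r \<oplus>\<^bsub>Zp p\<^esub> (if a = d then s \<otimes>\<^bsub>Zp p\<^esub> r else \<zero>\<^bsub>Zp p\<^esub>)) \<otimes>\<^bsub>Zp p\<^esub> c d x"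
    using cl by (auto simp: R.l_distr R.r_distr R.m_assoc R.a_ac)
  also have "\<dots> = c a x" unfolding inverse using cl by simp
  finally show "c b (transvection a d s (transvection a d r x)) = c b x"
    using b assms(1-5) t by auto
qed (use assms transvection(1) in auto)

definition equivalent :: "'m \<Rightarrow> 'm \<Rightarrow> bool" where
  "equivalent v w \<longleftrightarrow> w \<in> orbit (Aut_filt (Zp p) M) (\<lambda>g. g) v"

lemma equivalent_iff: "equivalent v w \<longleftrightarrow> (\<exists>\<phi>\<in>filt_auts (Zp p) M. w = \<phi> v)"
  by (auto simp: equivalent_def orbit_def Aut_filt_def BijGroup_def)

lemma action: "group_action (Aut_filt (Zp p) M) (carrier M) (\<lambda>g. g)"
proof -
  have "filt_auts (Zp p) M \<subseteq> Bij (carrier M)"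
  proof
    fix \<phi> assume "\<phi> \<in> filt_auts (Zp p) M"
    then obtain \<psi> where "\<phi> \<in> carrier M \<rightarrow>\<^sub>E carrier M" "\<psi> \<in> carrier M \<rightarrow>\<^sub>E carrier M"
        "\<forall>x\<in>carrier M. \<psi> (\<phi> x) = x \<and> \<phi> (\<psi> x) = x"
      by (auto simp: filt_auts_def filt_hom_def)
    then show "\<phi> \<in> Bij (carrier M)"
      by (auto simp: Bij_def PiE_def intro!: bij_betw_byWitness[of _ \<psi>])
  qed
  then show ?thesis
    using group_Aut_filt[OF filtered_module_axioms] group_BijGroup[of "carrier M"]
    unfolding group_action_def group_hom_def group_hom_axioms_def
    by (auto simp: hom_def Aut_filt_def BijGroup_def)
qed

lemma equivalent_sym: "\<lbrakk>v \<in> carrier M; w \<in> carrier M; equivalent v w\<rbrakk> \<Longrightarrow> equivalent w v"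
  and equivalent_trans: "\<lbrakk>v \<in> carrier M; w \<in> carrier M; z \<in> carrier M;
    equivalent v w; equivalent w z\<rbrakk> \<Longrightarrow> equivalent v z"
  and equivalent_refl: "v \<in> carrier M \<Longrightarrow> equivalent v v"
  unfolding equivalent_def
  by (blast intro: group_action.orbit_sym[OF action] group_action.orbit_trans[OF action]
      group_action.orbit_refl[OF action])+

text \<open>
  The transvection with factor \<open>r = (y - c a v) / c d v\<close> does this. As the numerator vanishes
  modulo \<open>p^e\<close> and the denominator has order b, r is divisible by \<open>p^(e - b)\<close>, which is enough by
  the comparison of weights. For \<open>a = d\<close> it rescales the coordinate \<open>a\<close>, which is invertible only if
  \<open>y\<close> has the same order as \<open>c a v\<close>.
\<close>

lemma change_coordinate:
  assumes a: "a \<in> A" and d: "d \<in> A" and v: "v \<in> carrier M" and y: "y \<in> carrier (Zp p)"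
    and b: "c d v b = 0" "c d v (Suc b) \<noteq> 0"
    and e: "c a v e = 0" "y e = 0" "b \<le> e" "(\<rho> ^^ b) (\<iota> d) \<le> (\<rho> ^^ e) (\<iota> a)"
    and same: "a = d \<Longrightarrow> y (Suc b) \<noteq> 0"
  shows "\<exists>w\<in>carrier M. equivalent v w \<and> c a w = y \<and> (\<forall>a'\<in>A. a' \<noteq> a \<longrightarrow> c a' w = c a' v)"
proof -
  define k where "k = e - b"
  have ek: "e = b + k" using e(3) by (simp add: k_def)
  have k: "\<iota> d \<le> (\<rho> ^^ k) (\<iota> a)"
    using shift_pow_cancel[OF shift \<iota>_ge_1[OF d] \<iota>_ge_1[OF a], of b k] e(4) ek by simp
  have cl: "c a v \<in> carrier (Zp p)" "c d v \<in> carrier (Zp p)" using c_closed a d v by auto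
  define z where "z = y \<oplus>\<^bsub>Zp p\<^esub> (\<ominus>\<^bsub>Zp p\<^esub> c a v)"
  have zc: "z \<in> carrier (Zp p)" using y cl by (simp add: z_def)
  have ez: "c a v \<oplus>\<^bsub>Zp p\<^esub> z = y" unfolding z_def using y cl by (simp add: R.a_lcomm R.r_neg)
  have "y e = (c a v e + z e) mod int p ^ e" using ez Zp_simps(2) by metis
  then have "z e = 0" using e(1,2) Zp_mod_self[OF zc, of e] by simp
  then obtain r where r: "r \<in> carrier (Zp p)" "r k = 0" "r \<otimes>\<^bsub>Zp p\<^esub> c d v = z"
    using Zp_quotient[OF prime cl(2) b zc, of k] ek by auto
  have "\<exists>s\<in>carrier (Zp p). s k = 0 \<and>
    s \<oplus>\<^bsub>Zp p\<^esub> r \<oplus>\<^bsub>Zp p\<^esub> (if a = d then s \<otimes>\<^bsub>Zp p\<^esub> r else \<zero>\<^bsub>Zp p\<^esub>) = \<zero>\<^bsub>Zp p\<^esub>"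
  proof (cases "a = d")
    case False
    have "(\<ominus>\<^bsub>Zp p\<^esub> r) \<oplus>\<^bsub>Zp p\<^esub> r = \<zero>\<^bsub>Zp p\<^esub>" using r(1) by (simp add: R.l_neg)
    then have "((\<ominus>\<^bsub>Zp p\<^esub> r) k + r k) mod int p ^ k = 0" by (metis Zp_simps(1,2))
    then have "(\<ominus>\<^bsub>Zp p\<^esub> r) k = 0" using r Zp_mod_self[of "\<ominus>\<^bsub>Zp p\<^esub> r" p k] by simp
    then show ?thesis using False r(1) by (auto intro!: bexI[of _ "\<ominus>\<^bsub>Zp p\<^esub> r"] simp: R.l_neg)
  next
    case True
    \<comment> \<open>Here \<open>1 + r\<close> is a unit, being the quotient of two elements of order b, and s is determined
      by \<open>1 + s = 1 / (1 + r)\<close>. As \<open>e = b\<close>, divisibility by \<open>p^k\<close> is void.\<close>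
    have "e \<le> b"
      using b(2) e(1) True Zp_vanish_mono[OF cl(1), of e "Suc b"] by (metis not_less_eq_eq)
    then have eb: "e = b" "k = 0" using ek by auto
    define u where "u = \<one>\<^bsub>Zp p\<^esub> \<oplus>\<^bsub>Zp p\<^esub> r"
    have u: "u \<in> carrier (Zp p)" using r by (simp add: u_def)
    have uy: "u \<otimes>\<^bsub>Zp p\<^esub> c d v = y"
      using ez r True cl by (simp add: u_def R.l_distr)
    have "u 1 \<noteq> 0"
      using Zp_mult_vanish[OF u _ cl(2) b(1), of 1] uy same[OF True] by auto
    then obtain w where w: "w \<in> carrier (Zp p)" "u \<otimes>\<^bsub>Zp p\<^esub> w = \<one>\<^bsub>Zp p\<^esub>"
      using Zp_unit[OF prime u] by blast
    define s where "s = w \<oplus>\<^bsub>Zp p\<^esub> (\<ominus>\<^bsub>Zp p\<^esub> \<one>\<^bsub>Zp p\<^esub>)"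
    have s: "s \<in> carrier (Zp p)" using w by (simp add: s_def)
    have "s \<oplus>\<^bsub>Zp p\<^esub> r \<oplus>\<^bsub>Zp p\<^esub> s \<otimes>\<^bsub>Zp p\<^esub> r = s \<otimes>\<^bsub>Zp p\<^esub> u \<oplus>\<^bsub>Zp p\<^esub> r"
      using s r by (simp add: u_def R.r_distr R.a_ac)
    also have "s \<otimes>\<^bsub>Zp p\<^esub> u = \<one>\<^bsub>Zp p\<^esub> \<oplus>\<^bsub>Zp p\<^esub> (\<ominus>\<^bsub>Zp p\<^esub> u)"
      using w u by (simp add: s_def R.l_distr R.m_comm[of w] R.l_minus)
    also have "\<dots> \<oplus>\<^bsub>Zp p\<^esub> r = (\<one>\<^bsub>Zp p\<^esub> \<oplus>\<^bsub>Zp p\<^esub> r) \<oplus>\<^bsub>Zp p\<^esub> (\<ominus>\<^bsub>Zp p\<^esub> u)"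
      using u r by (simp add: R.a_ac)
    also have "\<dots> = \<zero>\<^bsub>Zp p\<^esub>" using u by (simp add: u_def R.r_neg)
    finally have "s \<oplus>\<^bsub>Zp p\<^esub> r \<oplus>\<^bsub>Zp p\<^esub> s \<otimes>\<^bsub>Zp p\<^esub> r = \<zero>\<^bsub>Zp p\<^esub>" .
    moreover have "s 0 = 0" using s by (simp add: Zp_def) (metis int_one_le_iff_zero_less linorder_not_le order_antisym power_0)
    ultimately show ?thesis using True s eb by auto
  qed
  then obtain s where s: "s \<in> carrier (Zp p)" "s k = 0"
    "s \<oplus>\<^bsub>Zp p\<^esub> r \<oplus>\<^bsub>Zp p\<^esub> (if a = d then s \<otimes>\<^bsub>Zp p\<^esub> r else \<zero>\<^bsub>Zp p\<^esub>) = \<zero>\<^bsub>Zp p\<^esub>" by blast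
  then have s': "r \<oplus>\<^bsub>Zp p\<^esub> s \<oplus>\<^bsub>Zp p\<^esub> (if a = d then r \<otimes>\<^bsub>Zp p\<^esub> s else \<zero>\<^bsub>Zp p\<^esub>) = \<zero>\<^bsub>Zp p\<^esub>"
    using r(1) R.a_comm[of r s] R.m_comm[of r s] by (cases "a = d") simp_all
  have "transvection a d r \<in> filt_auts (Zp p) M"
    unfolding filt_auts_def
    using transvection_hom[OF a d r(1,2) k] transvection_hom[OF a d s(1,2) k]
      transvection_inverse[OF a d r(1) s(1) _ s(3)] transvection_inverse[OF a d s(1) r(1) _ s']
    by blast
  then show ?thesis
    using transvection[OF a d r(1) v] a r(3) ez
    by (intro bexI[of _ "transvection a d r v"]) (auto simp: equivalent_iff)
qed


subsection \<open>The invariant\<close>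

definition power_plus_filt :: "nat \<Rightarrow> nat \<Rightarrow> 'm set" where
  "power_plus_filt m n =
     {Zp_of_nat p (p ^ m) \<odot>\<^bsub>M\<^esub> y \<oplus>\<^bsub>M\<^esub> z | y z. y \<in> carrier M \<and> z \<in> filt M n}"

text \<open>
  Linearity preserves the multiples of \<open>p^m\<close>, and compatibility with the filtration preserves the
  step n.
\<close>

lemma equivalent_power_plus_filt:
  assumes "equivalent v w" "n \<ge> 1" "v \<in> power_plus_filt m n"
  shows "w \<in> power_plus_filt m n"
proof -
  obtain \<phi> where \<phi>: "\<phi> \<in> filt_hom (Zp p) M M" "w = \<phi> v"
    using assms(1) by (auto simp: equivalent_iff filt_auts_def)
  obtain y z where v: "v = Zp_of_nat p (p ^ m) \<odot>\<^bsub>M\<^esub> y \<oplus>\<^bsub>M\<^esub> z" "y \<in> carrier M" "z \<in> filt M n"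
    using assms(3) by (auto simp: power_plus_filt_def)
  have "w = Zp_of_nat p (p ^ m) \<odot>\<^bsub>M\<^esub> \<phi> y \<oplus>\<^bsub>M\<^esub> \<phi> z" "\<phi> y \<in> carrier M" "\<phi> z \<in> filt M n"
    using \<phi> v filt_closed[OF assms(2)] assms(2) Zp_of_nat_closed[OF p_pos]
    by (auto simp: filt_hom_def image_subset_iff)
  then show ?thesis by (auto simp: power_plus_filt_def)
qed

lemma equivalent_power_plus_filt_iff:
  assumes "v \<in> carrier M" "w \<in> carrier M" "equivalent v w" "n \<ge> 1"
  shows "v \<in> power_plus_filt m n \<longleftrightarrow> w \<in> power_plus_filt m n"
  using equivalent_power_plus_filt equivalent_sym assms by blast

text \<open>
  Membership can be tested in each coordinate: in \<open>S i\<close>, both \<open>p^m\<close> and the step n cut out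
  ideals generated by powers of p, and the sum of two such ideals is the larger one.
\<close>

lemma power_plus_filt_iff:
  assumes v: "v \<in> carrier M" and n: "n \<ge> 1"
  shows "v \<in> power_plus_filt m n \<longleftrightarrow> (\<forall>a\<in>A. c a v \<noteq> \<zero>\<^bsub>Zp p\<^esub> \<longrightarrow>
    m \<le> Zp_ord p (c a v) \<or> n \<le> (\<rho> ^^ Zp_ord p (c a v)) (\<iota> a))"
proof
  assume "v \<in> power_plus_filt m n"
  then obtain y z where yz: "v = Zp_of_nat p (p ^ m) \<odot>\<^bsub>M\<^esub> y \<oplus>\<^bsub>M\<^esub> z" "y \<in> carrier M" "z \<in> filt M n"
    by (auto simp: power_plus_filt_def)
  have zM: "z \<in> carrier M" using filt_closed[OF n yz(3)] .
  show "\<forall>a\<in>A. c a v \<noteq> \<zero>\<^bsub>Zp p\<^esub> \<longrightarrow>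
    m \<le> Zp_ord p (c a v) \<or> n \<le> (\<rho> ^^ Zp_ord p (c a v)) (\<iota> a)"
  proof (intro ballI impI)
    fix a assume a: "a \<in> A" and nz: "c a v \<noteq> \<zero>\<^bsub>Zp p\<^esub>"
    obtain k where k: "n \<le> (\<rho> ^^ k) (\<iota> a)" "c a z k = 0"
      using yz(3) a S_filt_iff[OF shift \<iota>_ge_1[OF a] p_pos] unfolding filt_iff[OF n] by blast
    define q where "q = Zp_of_nat p (p ^ m) \<otimes>\<^bsub>Zp p\<^esub> c a y"
    have q: "q \<in> carrier (Zp p)" using c_closed[OF a yz(2)] Zp_of_nat_closed[OF p_pos] by (simp add: q_def)
    have qm: "q m = 0"
      using Zp_divides_iff[OF q p_pos, of m] c_closed[OF a yz(2)] by (auto simp: q_def factor_def)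
    have eq: "c a v = q \<oplus>\<^bsub>Zp p\<^esub> c a z"
      unfolding yz(1) q_def using a yz(2) zM Zp_of_nat_closed[OF p_pos] by (simp add: c_add c_smult)
    have "q (min m k) = 0" "c a z (min m k) = 0"
      using Zp_vanish_mono[OF q qm] Zp_vanish_mono[OF c_closed[OF a zM] k(2)] by auto
    then have "c a v (min m k) = 0" unfolding eq by (simp add: Zp_simps)
    then have "min m k \<le> Zp_ord p (c a v)"
      using Zp_ord_ge_iff[OF c_closed[OF a v] p_pos nz] by blast
    then show "m \<le> Zp_ord p (c a v) \<or> n \<le> (\<rho> ^^ Zp_ord p (c a v)) (\<iota> a)"
      using k(1) shift_pow_mono[OF shift \<iota>_ge_1[OF a], of k "Zp_ord p (c a v)"] by linarith
  qed
next
  assume R: "\<forall>a\<in>A. c a v \<noteq> \<zero>\<^bsub>Zp p\<^esub> \<longrightarrow>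
    m \<le> Zp_ord p (c a v) \<or> n \<le> (\<rho> ^^ Zp_ord p (c a v)) (\<iota> a)"
  have "\<exists>y z. y \<in> carrier (Zp p) \<and> z \<in> filt (S_mod p \<rho> (\<iota> a)) n \<and>
      c a v = Zp_of_nat p (p ^ m) \<otimes>\<^bsub>Zp p\<^esub> y \<oplus>\<^bsub>Zp p\<^esub> z" if a: "a \<in> A" for a
  proof (cases "c a v m = 0")
    case True
    then obtain y where "y \<in> carrier (Zp p)" "c a v = Zp_of_nat p (p ^ m) \<otimes>\<^bsub>Zp p\<^esub> y"
      using Zp_divides_iff[OF c_closed[OF a v] p_pos] by (auto simp: factor_def)
    moreover have "\<zero>\<^bsub>Zp p\<^esub> \<in> filt (S_mod p \<rho> (\<iota> a)) n" by (simp add: S_mod_def S_weight_def)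
    ultimately show ?thesis using c_closed[OF a v] by (intro exI[of _ y] exI[of _ "\<zero>\<^bsub>Zp p\<^esub>"]) simp
  next
    case False
    then have nz: "c a v \<noteq> \<zero>\<^bsub>Zp p\<^esub>" by (auto simp: Zp_simps)
    then have "n \<le> (\<rho> ^^ Zp_ord p (c a v)) (\<iota> a)"
      using R a False Zp_ord_ge_iff[OF c_closed[OF a v] p_pos nz] by blast
    then have "c a v \<in> filt (S_mod p \<rho> (\<iota> a)) n"
      using nz c_closed[OF a v] by (simp add: S_mod_def S_weight_def)
    then show ?thesis
      using c_closed[OF a v] Zp_of_nat_closed[OF p_pos]
      by (intro exI[of _ "\<zero>\<^bsub>Zp p\<^esub>"] exI[of _ "c a v"]) simp
  qed
  then obtain g h where gh: "\<And>a. a \<in> A \<Longrightarrow> g a \<in> carrier (Zp p)"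
      "\<And>a. a \<in> A \<Longrightarrow> h a \<in> filt (S_mod p \<rho> (\<iota> a)) n"
      "\<And>a. a \<in> A \<Longrightarrow> c a v = Zp_of_nat p (p ^ m) \<otimes>\<^bsub>Zp p\<^esub> g a \<oplus>\<^bsub>Zp p\<^esub> h a"
    by metis
  have h: "h a \<in> carrier (Zp p)" if "a \<in> A" for a using gh(2)[OF that] by (simp add: S_mod_def)
  have "vector h \<in> filt M n" using vector[of h] gh(2) h by (simp add: filt_iff[OF n])
  moreover have "v = Zp_of_nat p (p ^ m) \<odot>\<^bsub>M\<^esub> vector g \<oplus>\<^bsub>M\<^esub> vector h"
    by (rule c_ext) (use v gh h vector[of g] vector[of h] Zp_of_nat_closed[OF p_pos] in
      \<open>simp_all add: c_add c_smult\<close>)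
  ultimately show "v \<in> power_plus_filt m n"
    using vector(1)[of g] gh(1) by (auto simp: power_plus_filt_def)
qed

text \<open>
  Phrased through submodules stable under automorphisms, so that the invariance of the jump set
  under equivalence is immediate; \<open>has_jumps_iff\<close> gives the meaning in coordinates. The successors
  turn the strict inequalities \<open>b < m\<close>, \<open>w < n\<close> that obstruct membership into the weak ones of
  the upward closed set, and keep the filtration index positive.
\<close>

definition has_jumps :: "'m \<Rightarrow> nat set \<times> (nat \<Rightarrow> nat) \<Rightarrow> bool" where
  "has_jumps v J \<longleftrightarrow> jump_upset \<rho> J = {(m, n). v \<notin> power_plus_filt (Suc m) (Suc n)}"

lemma equivalent_has_jumps:
  "\<lbrakk>v \<in> carrier M; w \<in> carrier M; equivalent v w; has_jumps v J\<rbrakk> \<Longrightarrow> has_jumps w J"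
  by (simp add: has_jumps_def equivalent_power_plus_filt_iff)

lemma has_jumps_iff:
  assumes "v \<in> carrier M"
  shows "has_jumps v J \<longleftrightarrow> jump_upset \<rho> J = {(m, n). \<exists>a\<in>A. c a v \<noteq> \<zero>\<^bsub>Zp p\<^esub> \<and>
    Zp_ord p (c a v) \<le> m \<and> (\<rho> ^^ Zp_ord p (c a v)) (\<iota> a) \<le> n}"
proof -
  have "v \<notin> power_plus_filt (Suc m) (Suc n) \<longleftrightarrow> (\<exists>a\<in>A. c a v \<noteq> \<zero>\<^bsub>Zp p\<^esub> \<and>
    Zp_ord p (c a v) \<le> m \<and> (\<rho> ^^ Zp_ord p (c a v)) (\<iota> a) \<le> n)" for m n
    using power_plus_filt_iff[OF assms, of "Suc n" "Suc m"] by (auto simp: not_less_eq_eq)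
  then show ?thesis by (simp add: has_jumps_def)
qed

lemma has_jumps_exists:
  assumes v: "v \<in> carrier M" and "\<And>a. a \<in> A \<Longrightarrow> c a v 1 = 0"
  shows "\<exists>J\<in>Jump_star \<rho>. has_jumps v J"
proof -
  let ?P = "{(\<iota> a, Zp_ord p (c a v)) | a. a \<in> A \<and> c a v \<noteq> \<zero>\<^bsub>Zp p\<^esub>}"
  have "?P \<subseteq> T_star \<rho> \<times> {1..}"
    using \<iota> Zp_ord_ge_iff[OF c_closed[OF _ v] p_pos, of _ 1] assms(2) by auto
  from jump_set_of_points[OF shift T_fin this] obtain J where
    "J \<in> Jump_star \<rho>" "jump_upset \<rho> J = {(m, n). \<exists>(i, b)\<in>?P. b \<le> m \<and> (\<rho> ^^ b) i \<le> n}" by blast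
  then show ?thesis by (intro bexI[of _ J]) (auto simp: has_jumps_iff[OF v])
qed


subsection \<open>The normal form\<close>

definition normal_form :: "nat set \<times> (nat \<Rightarrow> nat) \<Rightarrow> 'm" where
  "normal_form J = vector (\<lambda>a. if \<iota> a \<in> fst J \<and> a = \<sigma> (\<iota> a)
     then Zp_of_nat p (p ^ snd J (\<iota> a)) else \<zero>\<^bsub>Zp p\<^esub>)"

lemma normal_form:
  shows "normal_form J \<in> carrier M"
    and "a \<in> A \<Longrightarrow> c a (normal_form J) = (if \<iota> a \<in> fst J \<and> a = \<sigma> (\<iota> a)
      then Zp_of_nat p (p ^ snd J (\<iota> a)) else \<zero>\<^bsub>Zp p\<^esub>)"
  unfolding normal_form_def using Zp_of_nat_closed[OF p_pos] by (auto simp: vector)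

lemma Zp_ord_power: "Zp_ord p (Zp_of_nat p (p ^ b)) = b"
  using Zp_ord_eqI[OF Zp_of_nat_closed[OF p_pos] p_pos] Zp_of_nat_power_vanish_iff[OF p_gt_1] by simp

lemma Zp_power_nonzero: "Zp_of_nat p (p ^ b) \<noteq> \<zero>\<^bsub>Zp p\<^esub>"
  using Zp_of_nat_power_vanish_iff[OF p_gt_1, of b "Suc b"] by (auto simp: Zp_simps)

lemma normal_form_has_jumps:
  assumes "J \<in> Jump_star \<rho>"
  shows "has_jumps (normal_form J) J"
proof -
  obtain I \<beta> where J: "J = (I, \<beta>)" by fastforce
  have I: "i \<in> T_star \<rho>" if "i \<in> I" for i using that assms by (auto simp: J Jump_star_def)
  have "(\<exists>a\<in>A. c a (normal_form J) \<noteq> \<zero>\<^bsub>Zp p\<^esub> \<and> Zp_ord p (c a (normal_form J)) \<le> m \<and>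
      (\<rho> ^^ Zp_ord p (c a (normal_form J))) (\<iota> a) \<le> n) \<longleftrightarrow>
    (\<exists>i\<in>I. \<beta> i \<le> m \<and> (\<rho> ^^ \<beta> i) i \<le> n)" (is "?L \<longleftrightarrow> ?R") for m n
  proof
    assume ?L
    then show ?R by (auto simp: normal_form(2) J Zp_ord_power split: if_splits)
  next
    assume ?R
    then obtain i where i: "i \<in> I" "\<beta> i \<le> m" "(\<rho> ^^ \<beta> i) i \<le> n" by blast
    then show ?L
      using \<sigma>[OF I[OF i(1)]]
      by (intro bexI[of _ "\<sigma> i"]) (auto simp: normal_form(2) J Zp_ord_power Zp_power_nonzero)
  qed
  then show ?thesis unfolding has_jumps_iff[OF normal_form(1)] by (simp add: jump_upset_def J)
qed

lemma normal_form_inj: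
  assumes "J \<in> Jump_star \<rho>" "J' \<in> Jump_star \<rho>" "equivalent (normal_form J) (normal_form J')"
  shows "J = J'"
proof -
  have "has_jumps (normal_form J') J"
    using equivalent_has_jumps[OF _ _ assms(3)] normal_form(1) normal_form_has_jumps assms(1) by blast
  then have "jump_upset \<rho> J = jump_upset \<rho> J'"
    using normal_form_has_jumps[OF assms(2)] by (simp add: has_jumps_def)
  then show ?thesis by (rule jump_upset_inj[OF shift assms(1,2)])
qed

text \<open>
  If some preferred coordinate of weight \<open>i \<in> I\<close> differs from \<open>p^(\<beta> i)\<close>, the minimal point of i is
  nevertheless attained by a coordinate d of the same weight (possibly the preferred one), and
  minimality makes the wrong coordinate divisible by \<open>p^(\<beta> i)\<close>, so it can be corrected by means of
  d. Once all of these are right, any other nonzero coordinate has its point above a minimal one and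
  is cleared against the corresponding preferred coordinate.
\<close>

lemma fix_one_coordinate:
  assumes J: "J \<in> Jump_star \<rho>" and v: "v \<in> carrier M" "has_jumps v J" and ne: "v \<noteq> normal_form J"
  shows "\<exists>a\<in>A. c a v \<noteq> c a (normal_form J) \<and> (\<exists>w\<in>carrier M. equivalent v w \<and>
    c a w = c a (normal_form J) \<and> (\<forall>a'\<in>A. a' \<noteq> a \<longrightarrow> c a' w = c a' v))"
proof -
  obtain I \<beta> where J': "J = (I, \<beta>)" by fastforce
  have I: "i \<in> T_star \<rho>" if "i \<in> I" for i using that J by (auto simp: J' Jump_star_def)
  note nf = normal_form(2)[of _ J]
  have up: "(m, n) \<in> jump_upset \<rho> (I, \<beta>) \<longleftrightarrow> (\<exists>a\<in>A. c a v \<noteq> \<zero>\<^bsub>Zp p\<^esub> \<and>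
    Zp_ord p (c a v) \<le> m \<and> (\<rho> ^^ Zp_ord p (c a v)) (\<iota> a) \<le> n)" for m n
    using has_jumps_iff[OF v(1)] v(2) J' by auto
  have up_self: "(Zp_ord p (c a v), (\<rho> ^^ Zp_ord p (c a v)) (\<iota> a)) \<in> jump_upset \<rho> (I, \<beta>)"
    if "a \<in> A" "c a v \<noteq> \<zero>\<^bsub>Zp p\<^esub>" for a unfolding up using that by blast
  have minimal: "\<iota> a = i \<and> Zp_ord p (c a v) = \<beta> i"
    if "i \<in> I" "a \<in> A" "c a v \<noteq> \<zero>\<^bsub>Zp p\<^esub>" "Zp_ord p (c a v) \<le> \<beta> i"
      "(\<rho> ^^ Zp_ord p (c a v)) (\<iota> a) \<le> (\<rho> ^^ \<beta> i) i" for i a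
    using jump_upset_minimal[OF J[unfolded J'] shift that(1) \<iota>_ge_1[OF that(2)] up_self[OF that(2,3)]]
      that(4,5) .
  have pow: "Zp_of_nat p (p ^ b) b = 0" "Zp_of_nat p (p ^ b) (Suc b) \<noteq> 0" for b
    using Zp_of_nat_power_vanish_iff[OF p_gt_1] by auto
  show ?thesis
  proof (cases "\<exists>i\<in>I. c (\<sigma> i) v \<noteq> Zp_of_nat p (p ^ \<beta> i)")
    case True
    then obtain i where i: "i \<in> I" "c (\<sigma> i) v \<noteq> Zp_of_nat p (p ^ \<beta> i)" by blast
    note s = \<sigma>[OF I[OF i(1)]]
    have y: "c (\<sigma> i) (normal_form J) = Zp_of_nat p (p ^ \<beta> i)" using s i(1) nf[OF s(1)] J' by simp
    have "(\<beta> i, (\<rho> ^^ \<beta> i) i) \<in> jump_upset \<rho> (I, \<beta>)" using i(1) by (auto simp: jump_upset_def)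
    then obtain d where d: "d \<in> A" "c d v \<noteq> \<zero>\<^bsub>Zp p\<^esub>" "Zp_ord p (c d v) \<le> \<beta> i"
        "(\<rho> ^^ Zp_ord p (c d v)) (\<iota> d) \<le> (\<rho> ^^ \<beta> i) i" unfolding up by blast
    then have di: "\<iota> d = i" "Zp_ord p (c d v) = \<beta> i" using minimal[OF i(1)] by auto
    have dv: "c d v (\<beta> i) = 0" "c d v (Suc (\<beta> i)) \<noteq> 0"
      using Zp_ord_vanish[OF c_closed[OF d(1) v(1)] p_pos d(2)] di(2) by auto
    have "c (\<sigma> i) v (\<beta> i) = 0"
    proof (cases "c (\<sigma> i) v = \<zero>\<^bsub>Zp p\<^esub>")
      case False
      let ?o = "Zp_ord p (c (\<sigma> i) v)"
      have "\<beta> i \<le> ?o"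
      proof (rule ccontr)
        assume "\<not> \<beta> i \<le> ?o"
        then have lt: "?o < \<beta> i" by simp
        then have "(\<rho> ^^ ?o) i \<le> (\<rho> ^^ \<beta> i) i"
          using shift_pow_mono[OF shift, of i ?o "\<beta> i"] T_star_ge_1[OF I[OF i(1)]] by simp
        then show False using minimal[OF i(1) s(1) False] lt s(2) by simp
      qed
      then show ?thesis using Zp_ord_ge_iff[OF c_closed[OF s(1) v(1)] p_pos False] by blast
    qed (simp add: Zp_simps)
    from change_coordinate[OF s(1) d(1) v(1) Zp_of_nat_closed[OF p_pos] dv this pow(1) order_refl _ pow(2)]
    show ?thesis using y i(2) s di by (intro bexI[of _ "\<sigma> i"]) auto
  next
    case False
    obtain a where a: "a \<in> A" "c a v \<noteq> c a (normal_form J)"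
      using c_ext[OF v(1) normal_form(1)] ne by blast
    have na: "\<not> (\<iota> a \<in> I \<and> a = \<sigma> (\<iota> a))" using a False nf[OF a(1)] J' by auto
    then have y: "c a (normal_form J) = \<zero>\<^bsub>Zp p\<^esub>" using nf[OF a(1)] J' by auto
    then have nz: "c a v \<noteq> \<zero>\<^bsub>Zp p\<^esub>" using a(2) by simp
    obtain i where i: "i \<in> I" "\<beta> i \<le> Zp_ord p (c a v)"
        "(\<rho> ^^ \<beta> i) i \<le> (\<rho> ^^ Zp_ord p (c a v)) (\<iota> a)"
      using up_self[OF a(1) nz] by (auto simp: jump_upset_def)
    note s = \<sigma>[OF I[OF i(1)]]
    have cs: "c (\<sigma> i) v = Zp_of_nat p (p ^ \<beta> i)" using False i(1) by blast
    have "a \<noteq> \<sigma> i" using na s(2) i(1) by auto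
    then have "\<exists>w\<in>carrier M. equivalent v w \<and> c a w = \<zero>\<^bsub>Zp p\<^esub> \<and> (\<forall>a'\<in>A. a' \<noteq> a \<longrightarrow> c a' w = c a' v)"
      using change_coordinate[OF a(1) s(1) v(1) R.zero_closed, of "\<beta> i" "Zp_ord p (c a v)"]
        cs pow Zp_ord_vanish(1)[OF c_closed[OF a(1) v(1)] p_pos nz] i s(2) by (simp add: Zp_simps(1))
    then show ?thesis using a(1) nz y by (intro bexI[of _ a]) simp_all
  qed
qed

text \<open>
  Each correction leaves the remaining coordinates alone and, being an equivalence, keeps the jump
  set; so the number of wrong coordinates drops.
\<close>

lemma equivalent_normal_form:
  assumes J: "J \<in> Jump_star \<rho>" and "v \<in> carrier M" "has_jumps v J"
  shows "equivalent v (normal_form J)"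
  using assms(2,3)
proof (induction "card {a \<in> A. c a v \<noteq> c a (normal_form J)}" arbitrary: v rule: less_induct)
  case less
  show ?case
  proof (cases "v = normal_form J")
    case False
    obtain a w where
      a: "a \<in> A" "c a v \<noteq> c a (normal_form J)" and
      w: "w \<in> carrier M" "equivalent v w" "c a w = c a (normal_form J)"
        "\<forall>a'\<in>A. a' \<noteq> a \<longrightarrow> c a' w = c a' v"
      using fix_one_coordinate[OF J less.prems False] by (elim bexE conjE) (rule that)
    have "card {a \<in> A. c a w \<noteq> c a (normal_form J)} < card {a \<in> A. c a v \<noteq> c a (normal_form J)}"
    proof (rule psubset_card_mono)
      have "b \<noteq> a \<and> c b v \<noteq> c b (normal_form J)" if "b \<in> A" "c b w \<noteq> c b (normal_form J)" for b
        using that w(3,4) by metis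
      then show "{a \<in> A. c a w \<noteq> c a (normal_form J)} \<subset> {a \<in> A. c a v \<noteq> c a (normal_form J)}"
        using a by blast
    qed (use A_fin in simp)
    moreover have "has_jumps w J" using equivalent_has_jumps[OF less.prems(1) w(1,2) less.prems(2)] .
    ultimately have "equivalent w (normal_form J)" using less.hyps w(1) by blast
    then show ?thesis using equivalent_trans[OF less.prems(1) w(1) normal_form(1) w(2)] by blast
  qed (use less.prems equivalent_refl in simp)
qed

text \<open>
  The normal forms are representatives of the orbits in V. Prescribing the values of an orbit
  invariant on them therefore determines it.
\<close>

theorem unique_orbit_invariant:
  assumes V: "V \<subseteq> carrier M" "\<And>v a. v \<in> V \<Longrightarrow> a \<in> A \<Longrightarrow> c a v 1 = 0"
    and nf: "normal_form ` Jump_star \<rho> \<subseteq> V"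
  shows "\<exists>!filt_ord. filt_ord \<in> V \<rightarrow>\<^sub>E Jump_star \<rho> \<and>
    (\<forall>v\<in>V. \<forall>w\<in>V. equivalent v w \<longleftrightarrow> filt_ord v = filt_ord w) \<and>
    (\<forall>J\<in>Jump_star \<rho>. filt_ord (normal_form J) = J)"
proof -
  have ex: "\<exists>J\<in>Jump_star \<rho>. equivalent v (normal_form J)" if "v \<in> V" for v
    using has_jumps_exists[of v] equivalent_normal_form[of _ v] V that by blast
  have eqv: "equivalent v w \<Longrightarrow> equivalent w v" "equivalent v w \<Longrightarrow> equivalent w z \<Longrightarrow> equivalent v z"
    if "v \<in> V" "w \<in> V" "z \<in> V" for v w z
    using that V(1) equivalent_sym[of v w] equivalent_trans[of v w z] by blast+
  have nfV: "normal_form J \<in> V" if "J \<in> Jump_star \<rho>" for J using nf that by blast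
  define F where "F = (\<lambda>v\<in>V. SOME J. J \<in> Jump_star \<rho> \<and> equivalent v (normal_form J))"
  have F: "F v \<in> Jump_star \<rho>" "equivalent v (normal_form (F v))" if "v \<in> V" for v
    using someI_ex[of "\<lambda>J. J \<in> Jump_star \<rho> \<and> equivalent v (normal_form J)"] ex[OF that] that
    by (auto simp: F_def)
  have F_iff: "equivalent v w \<longleftrightarrow> F v = F w" if v: "v \<in> V" and w: "w \<in> V" for v w
  proof
    assume vw: "equivalent v w"
    have "equivalent (normal_form (F v)) v" using eqv(1)[OF v nfV v] F v by blast
    then have "equivalent (normal_form (F v)) w" using eqv(2)[OF nfV v w] F(1)[OF v] vw by blast
    then have "equivalent (normal_form (F v)) (normal_form (F w))"
      using eqv(2)[OF nfV w nfV] F v w by blast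
    then show "F v = F w" using normal_form_inj F(1) v w by blast
  next
    assume "F v = F w"
    then have "equivalent v (normal_form (F w))" "equivalent (normal_form (F w)) w"
      using F(2)[OF v] eqv(1)[OF w nfV w] F[OF w] by auto
    then show "equivalent v w" using eqv(2)[OF v nfV w] F(1)[OF w] by blast
  qed
  have F_nf: "F (normal_form J) = J" if J: "J \<in> Jump_star \<rho>" for J
    using normal_form_inj[OF J F(1)[OF nfV[OF J]] F(2)[OF nfV[OF J]]] by simp
  show ?thesis
  proof (rule ex1I[of _ F], intro conjI ballI)
    show "F \<in> V \<rightarrow>\<^sub>E Jump_star \<rho>" using F(1) by (auto simp: F_def)
  next
    fix G assume G: "G \<in> V \<rightarrow>\<^sub>E Jump_star \<rho> \<and>
      (\<forall>v\<in>V. \<forall>w\<in>V. equivalent v w \<longleftrightarrow> G v = G w) \<and> (\<forall>J\<in>Jump_star \<rho>. G (normal_form J) = J)"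
    have "G v = F v" if "v \<in> V" for v
      using G F[OF that] that nfV by metis
    moreover have "G \<in> extensional V" "F \<in> extensional V" using G by (auto simp: PiE_def F_def)
    ultimately show "G = F" by (intro extensionalityI)
  qed (use F_iff F_nf in auto)
qed

end


section \<open>Coordinates on the concrete module\<close>

text \<open>
  First component 0 stands for the summand \<open>M_rho_star\<close>, which contributes the preferred coordinate
  of each weight; the components from 1 to \<open>f - 1\<close> number the copies of \<open>M_rho\<close>.
\<close>

definition index_set :: "(nat \<Rightarrow> nat) \<Rightarrow> nat \<Rightarrow> (nat \<times> nat) set" where
  "index_set \<rho> f = {0} \<times> T_star \<rho> \<union> {1..f - 1} \<times> T_set \<rho>"

definition coordinate ::
  "nat \<times> nat \<Rightarrow> (nat \<Rightarrow> nat \<Rightarrow> nat \<Rightarrow> int) \<times> (nat \<Rightarrow> nat \<Rightarrow> int) \<Rightarrow> nat \<Rightarrow> int" where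
  "coordinate = (\<lambda>(k, i) x. if k = 0 then snd x i else fst x k i)"

lemma ball_index_set:
  "(\<forall>a\<in>index_set \<rho> f. P a) \<longleftrightarrow>
    (\<forall>i\<in>T_star \<rho>. P (0, i)) \<and> (\<forall>k\<in>{1..f - 1}. \<forall>i\<in>T_set \<rho>. P (k, i))"
  by (auto simp: index_set_def)

lemmas M_total_simps = M_total_def filt_sum_def M_rho_def M_rho_star_def filt_prod_def S_mod_def

lemma M_total_coordinates:
  assumes p: "Factorial_Ring.prime p" and \<rho>: "shift \<rho>" and fin: "finite (T_set \<rho>)"
  shows "weighted_coordinates p (M_total p \<rho> f) \<rho> (index_set \<rho> f) snd (\<lambda>i. (0, i)) coordinate"
proof -
  have p0: "p > 0" using p prime_gt_0_nat by blast
  interpret Z: cring "Zp p" using cring_Zp[OF p0] .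
  interpret filtered_module "Zp p" "M_total p \<rho> f" using filtered_module_M_total[OF \<rho> p0] .
  show ?thesis
  proof unfold_locales
    show "finite (index_set \<rho> f)" using fin by (simp add: index_set_def T_star_def)
  next
    fix x y assume x: "x \<in> carrier (M_total p \<rho> f)" and y: "y \<in> carrier (M_total p \<rho> f)"
      and eq: "\<And>a. a \<in> index_set \<rho> f \<Longrightarrow> coordinate a x = coordinate a y"
    have s: "snd x i = snd y i" if "i \<in> T_star \<rho>" for i
      using eq[of "(0, i)"] that by (simp add: index_set_def coordinate_def)
    have k: "fst x k i = fst y k i" if "k \<in> {1..f - 1}" "i \<in> T_set \<rho>" for k i
      using eq[of "(k, i)"] that by (simp add: index_set_def coordinate_def)
    have "snd x = snd y"
      by (rule extensionalityI[of _ "T_star \<rho>"]) (use x y s in \<open>auto simp: M_total_simps PiE_def\<close>)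
    have "fst x k = fst y k" if "k \<in> {1..f - 1}" for k
    proof -
      have "fst x k \<in> extensional (T_set \<rho>)" "fst y k \<in> extensional (T_set \<rho>)"
        using x y that by (auto simp: M_total_simps PiE_iff)
      then show ?thesis by (rule extensionalityI) (rule k[OF that])
    qed
    moreover have "fst x \<in> extensional {1..f - 1}" "fst y \<in> extensional {1..f - 1}"
      using x y by (auto simp: M_total_simps PiE_iff)
    ultimately have "fst x = fst y" using extensionalityI by metis
    then show "x = y" using \<open>snd x = snd y\<close> by (simp add: prod_eq_iff)
  next
    fix g assume g: "g \<in> index_set \<rho> f \<rightarrow> carrier (Zp p)"
    show "\<exists>x\<in>carrier (M_total p \<rho> f). \<forall>a\<in>index_set \<rho> f. coordinate a x = g a"
      by (rule bexI[of _ "(\<lambda>k\<in>{1..f - 1}. \<lambda>i\<in>T_set \<rho>. g (k, i), \<lambda>i\<in>T_star \<rho>. g (0, i))"])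
        (use g in \<open>auto simp: M_total_simps index_set_def coordinate_def Pi_iff\<close>)
  next
    fix n :: nat and x assume n: "n \<ge> 1"
    show "x \<in> filt (M_total p \<rho> f) n \<longleftrightarrow> x \<in> carrier (M_total p \<rho> f) \<and>
      (\<forall>a\<in>index_set \<rho> f. coordinate a x \<in> filt (S_mod p \<rho> (snd a)) n)"
      by (cases x) (auto simp: M_total_simps ball_index_set coordinate_def PiE_iff)
  qed (use p \<rho> fin in \<open>auto simp: M_total_simps index_set_def coordinate_def PiE_iff T_star_def\<close>)
qed

theorem theorem1p4:
  fixes p f :: nat and \<rho> :: "nat \<Rightarrow> nat"
  assumes "Factorial_Ring.prime p" and "shift \<rho>" and "finite (T_set \<rho>)" and "f \<ge> 1"
  shows "\<exists>!filt_ord.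
    filt_ord \<in> nat_multiples p (M_total p \<rho> f) \<rightarrow>\<^sub>E Jump_star \<rho> \<and>
    (\<forall>v\<^sub>1\<in>nat_multiples p (M_total p \<rho> f). \<forall>v\<^sub>2\<in>nat_multiples p (M_total p \<rho> f).
       v\<^sub>2 \<in> orbit (Aut_filt (Zp p) (M_total p \<rho> f)) (\<lambda>g. g) v\<^sub>1 \<longleftrightarrow> filt_ord v\<^sub>1 = filt_ord v\<^sub>2) \<and>
    (\<forall>J\<in>Jump_star \<rho>. filt_ord (jump_vector p \<rho> f J) = J)"
proof -
  interpret weighted_coordinates p "M_total p \<rho> f" \<rho> "index_set \<rho> f" snd "\<lambda>i. (0, i)" coordinate
    by (rule M_total_coordinates[OF assms(1-3)])
  let ?V = "nat_multiples p (M_total p \<rho> f)"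
  have mult: "coordinate a (add_pow (M_total p \<rho> f) k x) = add_pow (Zp p) k (coordinate a x)"
    if "a \<in> index_set \<rho> f" "x \<in> carrier (M_total p \<rho> f)" for a x and k :: nat
    by (induction k) (use that in \<open>simp_all add: c_add c_zero\<close>)
  have V: "?V \<subseteq> carrier (M_total p \<rho> f)" 
    unfolding nat_multiples_def by (intro image_subsetI M.add.nat_pow_closed)
  have V1: "coordinate a v 1 = 0" if v: "v \<in> ?V" and a: "a \<in> index_set \<rho> f" for v a
  proof -
    obtain x where x: "x \<in> carrier (M_total p \<rho> f)" "v = add_pow (M_total p \<rho> f) p x"
      using v unfolding nat_multiples_def by blast
    have y: "coordinate a x \<in> carrier (Zp p)" by (rule c_closed[OF a x(1)])
    have "coordinate a v = Zp_of_nat p (p ^ 1) \<otimes>\<^bsub>Zp p\<^esub> coordinate a x"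
      using mult[OF a x(1)] x(2) y by (simp add: Zp_of_nat_def R.add_pow_ldistr)
    then show ?thesis
      using Zp_divides_iff[OF c_closed[OF a subsetD[OF V v]] p_pos, of 1] y
      unfolding factor_def by blast
  qed
  have nf: "normal_form J = jump_vector p \<rho> f J" if J: "J \<in> Jump_star \<rho>" for J
  proof (rule c_ext)
    have jV: "jump_vector p \<rho> f J \<in> ?V" using jump_vector_mem[OF J p_pos assms(2)] .
    then show "jump_vector p \<rho> f J \<in> carrier (M_total p \<rho> f)" using V by blast
    fix a assume a: "a \<in> index_set \<rho> f"
    then show "coordinate a (normal_form J) = coordinate a (jump_vector p \<rho> f J)"
      unfolding normal_form(2)[OF a]
      by (cases J) (auto simp: jump_vector_def coordinate_def index_set_def M_total_simps)
  qed (rule normal_form(1))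
  show ?thesis
    using unique_orbit_invariant[of ?V] V V1 nf jump_vector_mem[OF _ p_pos assms(2)]
    by (simp add: image_subset_iff equivalent_def cong: conj_cong)
qed

end
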